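(* Let $t_0<T$, and assume the irregularity condition $\mathrm{Range}(B'P(t))\not\subseteq \mathrm{Range}(R)$ (i.e. the inclusion $\mathrm{Range}(B'P(t))\subseteq\mathrm{Range}(R)$ does not hold for all $t\in[t_0,T]$). Then Problem 1 is solvable if and only if there exists a symmetric $n\times n$ matrix function $P_1(t)$ on $[t_0,T]$, with some terminal value $P_1(T)$, satisfying $$0=\dot P_1(t)+P_1(t)A_0(t)+A_0'(t)P_1(t)+P_1(t)D_0P_1(t)$$ such that $$0=C_0(t)+B_0'P_1(t),\qquad t_0\le t\le T,$$ and, for each initial value $x_0\in\mathbb{R}^n$, there exists $u_1(t)\in\mathbb{R}^{m-m_0}$ that achieves $$P_1(T)x(T)=0,$$ where $x(t)$ obeys $$\dot x(t)=\big(A_0(t)+D_0P_1(t)\big)x(t)+B_0u_1(t),\qquad x(t_0)=x_0 .$$ In this case, an optimal controller is $$u(t)=-R^{\dagger}B'\big(P(t)+P_1(t)\big)x(t)+G_0u_1(t),$$ and the optimal cost is $$J_T^*(t_0,x_0;u^* )=x_0'\big(P(t_0)+P_1(t_0)\big)x_0 .$$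
   Context: Setting: $'$ denotes transpose, $M^{\dagger}$ the Moore--Penrose inverse. $A\in\mathbb{R}^{n\times n}$ and $B\in\mathbb{R}^{n\times m}$ are constant matrices; $Q\ge0$, $H\ge 0$ (both $n\times n$) and $R\ge 0$ ($m\times m$) are symmetric positive semidefinite. The system is $\dot x(t)=Ax(t)+Bu(t)$, $x(t_0)=x_0$, with $x\in\mathbb{R}^n$, $u\in\mathbb{R}^m$, and the cost is $$J_T(t_0,x_0;u)=\int_{t_0}^T[x'(t)Qx(t)+u'(t)Ru(t)]\,dt+x'(T)Hx(T).$$ Problem 1: for any given initial pair $(t_0,x_0)$ find $u^*$ with $J_T^*(t_0,x_0;u^* )=\min_{u(\cdot)}J_T(t_0,x_0;u)$, where controls are square-integrable on $[t_0,T]$. For fixed $t_0$, "Problem 1 is solvable" means that for every $x_0\in\mathbb{R}^n$ a minimizing control exists. $P(t)$ denotes the solution on $[t_0,T]$ (assumed to exist) of the Riccati equation $0=\dot P(t)+A'P(t)+P(t)A+Q-P(t)BR^{\dagger}B'P(t)$, $P(T)=H$. Let $m_0=\mathrm{rank}(R)<m$, so $\mathrm{rank}(I-R^{\dagger}R)=m-m_0>0$. Fix an invertible $m\times m$ (elementary row transformation) matrix $T_0$ such that $T_0(I-R^{\dagger}R)=\begin{bmatrix}0\\ \Upsilon_{T_0}\end{bmatrix}$ with $\Upsilon_{T_0}\in\mathbb{R}^{(m-m_0)\times m}$ of full row rank. Define $A_0(t)=A-BR^{\dagger}B'P(t)$, $D_0=-BR^{\dagger}B'$, and let $G_0$ ($m\times(m-m_0)$),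 $C_0'(t)$ ($n\times (m-m_0)$), $B_0$ ($n\times(m-m_0)$) be the last $m-m_0$ columns of the indicated matrices: $[\,\ast\ \ G_0\,]=T_0^{-1}$, $[\,\ast\ \ C_0'(t)\,]=P(t)B(I-R^{\dagger}R)T_0^{-1}$, $[\,\ast\ \ B_0\,]=B(I-R^{\dagger}R)T_0^{-1}$. *)

theory Defs
  imports "HOL-Analysis.Analysis"
begin


definition psd :: "real^'n^'n \<Rightarrow> bool" where
  "psd M \<longleftrightarrow> transpose M = M \<and> (\<forall>x. 0 \<le> x \<bullet> (M *v x))"

definition is_pinv :: "real^'n^'m \<Rightarrow> real^'m^'n \<Rightarrow> bool" where
  "is_pinv M X \<longleftrightarrow>
     M ** X ** M = M \<and> X ** M ** X = X \<and>
     transpose (M ** X) = M ** X \<and> transpose (X ** M) = X ** M"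

text \<open>The Moore--Penrose inverse; existence and uniqueness are shown below.\<close>

definition pinv :: "real^'n^'m \<Rightarrow> real^'m^'n" where
  "pinv M = (THE X. is_pinv M X)"

lemma is_pinv_unique:
  assumes X: "is_pinv M X" and Y: "is_pinv M Y"
  shows "X = Y"
proof -
  have MX: "M ** X = M ** Y"
  proof -
    have "M ** X = transpose ((M ** Y ** M) ** X)"
      using X Y by (simp add: is_pinv_def)
    also have "\<dots> = transpose ((M ** Y) ** (M ** X))"
      by (simp add: matrix_mul_assoc)
    also have "\<dots> = transpose (M ** X) ** transpose (M ** Y)"
      by (rule matrix_transpose_mul)
    also have "\<dots> = (M ** X) ** (M ** Y)"
      using X Y by (simp add: is_pinv_def)
    also have "\<dots> = (M ** X ** M) ** Y"
      by (simp add: matrix_mul_assoc)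
    also have "\<dots> = M ** Y"
      using X by (simp add: is_pinv_def)
    finally show ?thesis .
  qed
  have XM: "X ** M = Y ** M"
  proof -
    have "X ** M = transpose (X ** (M ** Y ** M))"
      using X Y by (simp add: is_pinv_def)
    also have "\<dots> = transpose ((X ** M) ** (Y ** M))"
      by (simp add: matrix_mul_assoc)
    also have "\<dots> = transpose (Y ** M) ** transpose (X ** M)"
      by (rule matrix_transpose_mul)
    also have "\<dots> = (Y ** M) ** (X ** M)"
      using X Y by (simp add: is_pinv_def)
    also have "\<dots> = Y ** (M ** X ** M)"
      by (simp add: matrix_mul_assoc)
    also have "\<dots> = Y ** M"
      using X by (simp add: is_pinv_def)
    finally show ?thesis .
  qed
  have "X = X ** M ** X" using X by (simp add: is_pinv_def)
  also have "\<dots> = Y ** (M ** X)" by (simp add: XM matrix_mul_assoc)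
  also have "\<dots> = Y ** M ** Y" by (simp add: MX matrix_mul_assoc)
  also have "\<dots> = Y" using Y by (simp add: is_pinv_def)
  finally show ?thesis .
qed

lemma is_pinv_exists:
  fixes M :: "real^'n^'m"
  shows "\<exists>X. is_pinv M X"
proof -
  let ?R = "range ((*v) (transpose M))"
  have subM: "subspace (range ((*v) N))" for N :: "real^'a^'b"
    by (simp add: linear_subspace_image subspace_UNIV)
  have adj: "(M *v x) \<bullet> y = x \<bullet> (transpose M *v y)" for x y
    by (metis dot_lmul_matrix inner_commute vector_transpose_matrix)
  have ker0: "M *v x = 0" if "transpose M *v (M *v x) = 0" for x
    using adj[of x "M *v x"] that by simp
  have uniq0: "x = 0" if "x \<in> ?R" "M *v x = 0" for x
  proof -
    obtain z where "x = transpose M *v z" using \<open>x \<in> ?R\<close> by auto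
    then have "x \<bullet> x = (M *v x) \<bullet> z" by (simp add: adj)
    with that show ?thesis by simp
  qed
  have ex: "\<exists>x\<in>?R. transpose M *v (M *v x) = transpose M *v y" for y
  proof -
    obtain r s where r: "r \<in> span (range ((*v) M))"
      and s: "\<And>w. w \<in> span (range ((*v) M)) \<Longrightarrow> orthogonal s w" and y: "y = r + s"
      using orthogonal_subspace_decomp_exists by metis
    have "r \<in> range ((*v) M)" using r subM[of M] by (simp add: span_eq_iff[THEN iffD2])
    then obtain x' where x': "r = M *v x'" by auto
    obtain p q where p: "p \<in> span ?R"
      and q: "\<And>w. w \<in> span ?R \<Longrightarrow> orthogonal q w" and pq: "x' = p + q"
      using orthogonal_subspace_decomp_exists by metis
    have pR: "p \<in> ?R" using p subM[of "transpose M"] by (simp add: span_eq_iff[THEN iffD2])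
    have "(M *v q) \<bullet> (M *v q) = 0"
      unfolding adj using q[of "transpose M *v (M *v q)"]
      by (simp add: orthogonal_def span_base)
    then have Mq: "M *v q = 0" by simp
    have "(transpose M *v s) \<bullet> (transpose M *v s) = 0"
      using s[of "M *v (transpose M *v s)"] adj[of "transpose M *v s" s]
      by (simp add: orthogonal_def span_base inner_commute)
    then have "transpose M *v s = 0" by simp
    then have "transpose M *v (M *v p) = transpose M *v y"
      using Mq x' pq y by (simp add: matrix_vector_right_distrib)
    with pR show ?thesis by blast
  qed
  then obtain f where fR: "\<And>y. f y \<in> ?R"
    and f: "\<And>y. transpose M *v (M *v f y) = transpose M *v y"
    by metis
  have fI: "f y = x" if "x \<in> ?R" "transpose M *v (M *v x) = transpose M *v y" for x y
  proof -
    have "f y - x \<in> ?R" using fR that(1) subM subspace_diff by blast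
    moreover have "M *v (f y - x) = 0"
      by (rule ker0) (simp add: matrix_vector_mult_diff_distrib f that(2) del: transpose_matrix_vector)
    ultimately show ?thesis using uniq0 by fastforce
  qed
  have "linear f"
  proof (rule linearI)
    fix a b :: "real^'m" and c :: real
    show "f (a + b) = f a + f b"
      by (rule fI) (auto simp: fR subM subspace_add matrix_vector_right_distrib f simp del: transpose_matrix_vector)
    show "f (c *\<^sub>R a) = c *\<^sub>R f a"
      by (rule fI) (auto simp: fR subM subspace_scale matrix_vector_mult_scaleR f simp del: transpose_matrix_vector)
  qed
  then have Xv: "matrix f *v y = f y" for y by (simp add: matrix_works)
  have symI: "transpose N = N" if "\<And>x y. (N *v x) \<bullet> y = x \<bullet> (N *v y)" for N :: "real^'a^'a"
  proof -
    have "transpose N *v x = N *v x" for x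
    proof -
      have "(transpose N *v x) \<bullet> y = (N *v x) \<bullet> y" for y
        by (metis dot_lmul_matrix that transpose_matrix_vector)
      then show ?thesis by (metis vector_eq_rdot)
    qed
    then show ?thesis by (simp add: matrix_eq)
  qed
  have Mf: "M *v f (M *v x) = M *v x" for x
  proof -
    have "M *v (f (M *v x) - x) = 0"
      by (rule ker0) (simp add: matrix_vector_mult_diff_distrib f del: transpose_matrix_vector)
    then show ?thesis by (simp add: matrix_vector_mult_diff_distrib)
  qed
  have fMf: "f (M *v f y) = f y" for y by (rule fI) (simp_all add: fR f del: transpose_matrix_vector)
  have pr1: "(M *v f y) \<bullet> z = (M *v f y) \<bullet> (M *v f z)" for y z
    using f[of z] by (simp add: adj)
  have pr2: "f (M *v x) \<bullet> w = f (M *v x) \<bullet> f (M *v w)" for x w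
  proof -
    obtain z where z: "f (M *v x) = transpose M *v z" using fR by blast
    have "(transpose M *v z) \<bullet> v = z \<bullet> (M *v v)" for v
      using adj[of v z] by (simp add: inner_commute)
    then show ?thesis unfolding z by (simp add: Mf)
  qed
  have "is_pinv M (matrix f)"
    unfolding is_pinv_def
  proof (intro conjI)
    show "M ** matrix f ** M = M"
      by (simp add: matrix_eq matrix_vector_mul_assoc[symmetric] Xv Mf)
    show "matrix f ** M ** matrix f = matrix f"
      by (simp add: matrix_eq matrix_vector_mul_assoc[symmetric] Xv fMf)
    show "transpose (M ** matrix f) = M ** matrix f"
      by (rule symI) (metis pr1 inner_commute matrix_vector_mul_assoc Xv)
    show "transpose (matrix f ** M) = matrix f ** M"
      by (rule symI) (metis pr2 inner_commute matrix_vector_mul_assoc Xv)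
  qed
  then show ?thesis by blast
qed

lemma is_pinv_pinv: "is_pinv M (pinv M)"
  unfolding pinv_def by (rule theI') (use is_pinv_exists is_pinv_unique in blast)

text \<open>
  Index types carry no order, so a distinguished block of rows or columns (such as ``the last
  \<open>k\<close> ones'') is given by an injection \<open>\<iota>\<close> of the index type of the block into the full index
  type.
\<close>

definition select_rows :: "('k \<Rightarrow> 'm) \<Rightarrow> real^'n^'m \<Rightarrow> real^'n^'k" where
  "select_rows \<iota> M = (\<chi> i j. M $ \<iota> i $ j)"

definition select_columns :: "('k \<Rightarrow> 'm) \<Rightarrow> real^'m^'n \<Rightarrow> real^'k^'n" where
  "select_columns \<iota> M = (\<chi> i j. M $ i $ \<iota> j)"



definition square_integrable :: "real \<Rightarrow> real \<Rightarrow> (real \<Rightarrow> real^'m) \<Rightarrow> bool" where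
  "square_integrable t0 T u \<longleftrightarrow>
     u \<in> borel_measurable (lebesgue_on {t0..T}) \<and>
     integrable (lebesgue_on {t0..T}) (\<lambda>t. (norm (u t))\<^sup>2)"

text \<open>
  Since \<open>u\<close> is only square-integrable, \<open>x' = F x + G u\<close>, \<open>x t0 = x0\<close> is read in the
  Caratheodory sense, i.e. as an integral equation on \<open>[t0, T]\<close>.  (The equation
  forces \<open>x\<close> to be continuous there, as an indefinite integral; for continuous \<open>F\<close> and
  square-integrable \<open>u\<close> the integrand is therefore Lebesgue integrable and \<open>x\<close> absolutely
  continuous.)
\<close>

definition solves_linear_ode ::
  "(real \<Rightarrow> real^'n^'n) \<Rightarrow> real^'m^'n \<Rightarrow> real \<Rightarrow> real \<Rightarrow> real^'n \<Rightarrow>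
   (real \<Rightarrow> real^'m) \<Rightarrow> (real \<Rightarrow> real^'n) \<Rightarrow> bool" where
  "solves_linear_ode F G t0 T x0 u x \<longleftrightarrow>
     (\<forall>t\<in>{t0..T}. ((\<lambda>s. F s *v x s + G *v u s) has_integral (x t - x0)) {t0..t})"

definition lq_cost ::
  "real^'n^'n \<Rightarrow> real^'m^'m \<Rightarrow> real^'n^'n \<Rightarrow> real \<Rightarrow> real \<Rightarrow>
   (real \<Rightarrow> real^'n) \<Rightarrow> (real \<Rightarrow> real^'m) \<Rightarrow> real" where
  "lq_cost Q R H t0 T x u =
     integral {t0..T} (\<lambda>t. x t \<bullet> (Q *v x t) + u t \<bullet> (R *v u t)) + x T \<bullet> (H *v x T)"

definition lq_admissible ::
  "real^'n^'n \<Rightarrow> real^'m^'n \<Rightarrow> real \<Rightarrow> real \<Rightarrow> real^'n \<Rightarrow>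
   (real \<Rightarrow> real^'n) \<Rightarrow> (real \<Rightarrow> real^'m) \<Rightarrow> bool" where
  "lq_admissible A B t0 T x0 x u \<longleftrightarrow>
     square_integrable t0 T u \<and> solves_linear_ode (\<lambda>_. A) B t0 T x0 u x"

text \<open>
  On \<open>[t0, T]\<close> the state \<open>x\<close> is determined by \<open>x0\<close> and \<open>u\<close>, so minimising over admissible pairs
  is minimising over square-integrable controls.
\<close>

definition lq_optimal ::
  "real^'n^'n \<Rightarrow> real^'m^'n \<Rightarrow> real^'n^'n \<Rightarrow> real^'m^'m \<Rightarrow> real^'n^'n \<Rightarrow>
   real \<Rightarrow> real \<Rightarrow> real^'n \<Rightarrow> (real \<Rightarrow> real^'n) \<Rightarrow> (real \<Rightarrow> real^'m) \<Rightarrow> bool" where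
  "lq_optimal A B Q R H t0 T x0 x u \<longleftrightarrow>
     lq_admissible A B t0 T x0 x u \<and>
     (\<forall>y v. lq_admissible A B t0 T x0 y v \<longrightarrow>
        lq_cost Q R H t0 T x u \<le> lq_cost Q R H t0 T y v)"

definition lq_solvable ::
  "real^'n^'n \<Rightarrow> real^'m^'n \<Rightarrow> real^'n^'n \<Rightarrow> real^'m^'m \<Rightarrow> real^'n^'n \<Rightarrow>
   real \<Rightarrow> real \<Rightarrow> bool" where
  "lq_solvable A B Q R H t0 T \<longleftrightarrow> (\<forall>x0. \<exists>u x. lq_optimal A B Q R H t0 T x0 x u)"

definition solves_riccati ::
  "real^'n^'n \<Rightarrow> real^'m^'n \<Rightarrow> real^'n^'n \<Rightarrow> real^'m^'m \<Rightarrow> real^'n^'n \<Rightarrow>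
   real \<Rightarrow> real \<Rightarrow> (real \<Rightarrow> real^'n^'n) \<Rightarrow> bool" where
  "solves_riccati A B Q R H t0 T P \<longleftrightarrow>
     (\<forall>t\<in>{t0..T}. \<exists>P'. (P has_vector_derivative P') (at t within {t0..T}) \<and>
        0 = P' + transpose A ** P t + P t ** A + Q
              - P t ** B ** pinv R ** transpose B ** P t) \<and>
     P T = H"



definition solves_riccati1 ::
  "(real \<Rightarrow> real^'n^'n) \<Rightarrow> real^'n^'n \<Rightarrow> real \<Rightarrow> real \<Rightarrow> (real \<Rightarrow> real^'n^'n) \<Rightarrow> bool" where
  "solves_riccati1 A0 D0 t0 T P1 \<longleftrightarrow>
     (\<forall>t\<in>{t0..T}. \<exists>P1'. (P1 has_vector_derivative P1') (at t within {t0..T}) \<and>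
        0 = P1' + P1 t ** A0 t + transpose (A0 t) ** P1 t + P1 t ** D0 ** P1 t)"

definition steers_to_kernel ::
  "(real \<Rightarrow> real^'n^'n) \<Rightarrow> real^'n^'n \<Rightarrow> real^'k^'n \<Rightarrow> real \<Rightarrow> real \<Rightarrow> (real \<Rightarrow> real^'n^'n) \<Rightarrow>
   real^'n \<Rightarrow> (real \<Rightarrow> real^'k) \<Rightarrow> (real \<Rightarrow> real^'n) \<Rightarrow> bool" where
  "steers_to_kernel A0 D0 B0 t0 T P1 x0 u1 x \<longleftrightarrow>
     square_integrable t0 T u1 \<and>
     solves_linear_ode (\<lambda>t. A0 t + D0 ** P1 t) B0 t0 T x0 u1 x \<and>
     P1 T *v x T = 0"

definition irregular_solution ::
  "(real \<Rightarrow> real^'n^'n) \<Rightarrow> real^'n^'n \<Rightarrow> real^'k^'n \<Rightarrow> (real \<Rightarrow> real^'n^'k) \<Rightarrow>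
   real \<Rightarrow> real \<Rightarrow> (real \<Rightarrow> real^'n^'n) \<Rightarrow> bool" where
  "irregular_solution A0 D0 B0 C0 t0 T P1 \<longleftrightarrow>
     (\<forall>t\<in>{t0..T}. transpose (P1 t) = P1 t) \<and>
     solves_riccati1 A0 D0 t0 T P1 \<and>
     (\<forall>t\<in>{t0..T}. 0 = C0 t + transpose B0 ** P1 t) \<and>
     (\<forall>x0. \<exists>u1 x. steers_to_kernel A0 D0 B0 t0 T P1 x0 u1 x)"

end

theory Submission
  imports Defs
begin

text \<open>
  Write \<open>S = P + P1\<close> and let \<open>E = I - R^+ R\<close> be the orthogonal projection onto the kernel of \<open>R\<close>.
  The block form of \<open>T0 E\<close> amounts to a factorization \<open>E = G0 \<Upsilon>\<close> with \<open>R G0 = 0\<close>, and then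
  \<open>B0 = B G0\<close>, \<open>C0' = P B0\<close> (lemma \<open>kernel_factorization\<close>).  Since \<open>P\<close> is symmetric, the
  requirements on \<open>P1\<close>, apart from the steering condition, say precisely that \<open>S\<close> is a symmetric
  solution of the Riccati equation of \<open>P\<close>, with a terminal value of its own, such that \<open>S B0 = 0\<close>:
  displacing the state by a cost-free control does not change \<open>x' S x\<close>.

  From \<open>P1\<close> to optimality.  Along the closed loop the vector \<open>p = S x\<close> is a costate: \<open>p' = - A' p - Q x\<close>,
  because \<open>S B0 = 0\<close> makes \<open>u1\<close> disappear; \<open>R u = - B' p\<close>, because \<open>E B' S = 0\<close>; and \<open>p T = H x T\<close>,
  because \<open>P1 T x T = 0\<close>.  Hence the first variation of the cost vanishes at \<open>(x, u)\<close>.  The cost is a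
  nonnegative quadratic form in the pair of state and control, so a critical pair is minimal, and its
  cost is \<open>p t0 \<bullet> x0\<close> (lemma \<open>lq_optimal_of_costate\<close>).

  From solvability to \<open>P1\<close>.  Let \<open>p\<close> be the costate of an optimal pair.  Variations of the control in
  the kernel of \<open>R\<close> give \<open>B0' p = 0\<close> at all times, and the variation along \<open>u\<close> itself shows that the optimal
  cost is \<open>p t0 \<bullet> x0\<close> (lemma \<open>lq_optimal_costate\<close>).  Suppose that \<open>c\<close> is orthogonal to the costates of all
  optimal pairs, at all times.  Then the optimal cost from \<open>x0 = c\<close> is zero, which forces
  \<open>Q c = 0\<close>; differentiating \<open>p t \<bullet> c = 0\<close> now shows that \<open>A c\<close> is orthogonal to all costates as well.
  Starting from the range of \<open>B0\<close>, one finds that \<open>Q\<close> vanishes on the smallest \<open>A\<close>-invariant subspace \<open>N\<close>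
  containing this range, the controllable subspace of \<open>(A, B0)\<close>
  (lemma \<open>lq_solvable_controllable_kernel\<close>).

  The state can therefore be displaced inside \<open>N\<close> without any running cost, and only the minimum over \<open>N\<close>
  of the terminal cost matters.  This minimum is again a quadratic form, given by a generalized Schur
  complement \<open>H1\<close> of \<open>H\<close> (lemma \<open>psd_schur_complement\<close>).  The Riccati equation with terminal value \<open>H1\<close>
  has a solution \<open>S\<close> on the whole interval (lemma \<open>riccati_exists\<close>), which vanishes on \<open>N\<close> because \<open>H1\<close> and
  \<open>Q\<close> do, and \<open>P1 = S - P\<close> is the function sought.  The terminal condition \<open>P1 T x T = 0\<close> reads
  \<open>H1 x T = H x T\<close>; it is reached by adding to the free closed-loop response a trajectory inside \<open>N\<close>
  with a prescribed end point (lemma \<open>controllable_subspace_reachable\<close>).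
\<close>

section \<open>Matrix algebra\<close>

text \<open>
  Adjoints are written throughout as \<open>transpose M *v x\<close>; the default rules would turn some of them
  into \<open>x v* M\<close>.
\<close>

declare transpose_matrix_vector [simp del] vector_transpose_matrix [simp del]

lemma bounded_bilinear_matrix_vector:
  "bounded_bilinear ((*v) :: real^'n^'m \<Rightarrow> real^'n \<Rightarrow> real^'m)"
  unfolding bilinear_conv_bounded_bilinear[symmetric] bilinear_def
  by (auto intro!: linearI simp: matrix_vector_mult_add_rdistrib matrix_vector_right_distrib
      scaleR_matrix_vector_assoc matrix_vector_mult_scaleR)

lemma bounded_bilinear_matrix_matrix:
  "bounded_bilinear ((**) :: real^'n^'m \<Rightarrow> real^'k^'n \<Rightarrow> real^'k^'m)"
  unfolding bilinear_conv_bounded_bilinear[symmetric] bilinear_def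
  by (auto intro!: linearI simp: matrix_matrix_mult_def vec_eq_iff sum.distrib algebra_simps
      sum_distrib_left)

lemma bounded_linear_transpose: "bounded_linear (transpose :: real^'n^'m \<Rightarrow> real^'m^'n)"
  unfolding linear_conv_bounded_linear[symmetric]
  by (auto intro!: linearI simp: transpose_def vec_eq_iff)

lemmas matrix_vector_minus_left = bounded_bilinear.minus_left[OF bounded_bilinear_matrix_vector]
lemmas matrix_vector_minus_right = bounded_bilinear.minus_right[OF bounded_bilinear_matrix_vector]
lemmas transpose_add = linear_add[OF bounded_linear.linear[OF bounded_linear_transpose]]
lemmas transpose_diff = linear_diff[OF bounded_linear.linear[OF bounded_linear_transpose]]
lemmas transpose_minus = linear_neg[OF bounded_linear.linear[OF bounded_linear_transpose]]

lemma inner_matrix_vector_left: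
  fixes M :: "real^'n^'m"
  shows "(M *v x) \<bullet> y = x \<bullet> (transpose M *v y)"
  by (metis dot_lmul_matrix inner_commute vector_transpose_matrix)

lemma inner_transpose_matrix_vector:
  fixes M :: "real^'n^'m"
  shows "(transpose M *v x) \<bullet> y = x \<bullet> (M *v y)"
  by (metis inner_matrix_vector_left transpose_transpose)

lemmas matrix_mult_minus_left = bounded_bilinear.minus_left[OF bounded_bilinear_matrix_matrix]
lemmas matrix_mult_minus_right = bounded_bilinear.minus_right[OF bounded_bilinear_matrix_matrix]
lemmas matrix_mult_diff_left = bounded_bilinear.diff_left[OF bounded_bilinear_matrix_matrix]
lemmas matrix_mult_diff_right = bounded_bilinear.diff_right[OF bounded_bilinear_matrix_matrix]
lemmas matrix_mult_add_left = bounded_bilinear.add_left[OF bounded_bilinear_matrix_matrix]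
lemmas matrix_mult_add_right = bounded_bilinear.add_right[OF bounded_bilinear_matrix_matrix]
lemmas matrix_mult_zero_left = bounded_bilinear.zero_left[OF bounded_bilinear_matrix_matrix]
lemmas matrix_mult_zero_right = bounded_bilinear.zero_right[OF bounded_bilinear_matrix_matrix]
lemmas matrix_mult_scaleR_left = bounded_bilinear.scaleR_left[OF bounded_bilinear_matrix_matrix]
lemmas matrix_mult_scaleR_right = bounded_bilinear.scaleR_right[OF bounded_bilinear_matrix_matrix]

lemmas matrix_mult_bilinear =
  matrix_mult_minus_left matrix_mult_minus_right matrix_mult_diff_left matrix_mult_diff_right
  matrix_mult_add_left matrix_mult_add_right matrix_mult_scaleR_left matrix_mult_scaleR_right

lemma continuous_on_matrix_mult:
  fixes f :: "real \<Rightarrow> real^'n^'m" and g :: "real \<Rightarrow> real^'k^'n"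
  shows "continuous_on S f \<Longrightarrow> continuous_on S g \<Longrightarrow> continuous_on S (\<lambda>t. f t ** g t)"
  by (rule bounded_bilinear.continuous_on[OF bounded_bilinear_matrix_matrix])

lemma continuous_on_matrix_vector:
  fixes f :: "real \<Rightarrow> real^'n^'m"
  shows "continuous_on S f \<Longrightarrow> continuous_on S g \<Longrightarrow> continuous_on S (\<lambda>t. f t *v g t)"
  by (rule bounded_bilinear.continuous_on[OF bounded_bilinear_matrix_vector])

text \<open>
  The step from a nonnegative parabola through the origin to the vanishing of its slope, used for
  semidefinite forms on vectors and for the cost form on state-control pairs.
\<close>

lemma quadratic_nonneg_imp_linear_eq_0:
  fixes c d :: real
  assumes ge: "\<And>s. 0 \<le> 2 * s * c + s\<^sup>2 * d"
  shows "c = 0"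
proof -
  have "d \<ge> 0" using ge[of 1] ge[of "- 1"] by simp
  \<comment> \<open>The minimum of the parabola lies at \<open>- c / d\<close>; the shift by \<open>1\<close> avoids the case \<open>d = 0\<close>.\<close>
  define s where "s = - c / (d + 1)"
  have c: "c = - (s * (d + 1))" using \<open>d \<ge> 0\<close> by (simp add: s_def)
  have "0 \<le> 2 * s * c + s\<^sup>2 * d" by (rule ge)
  also have "\<dots> = - (s\<^sup>2 * (d + 2))" unfolding c by (simp add: power2_eq_square algebra_simps)
  finally have "s = 0" using \<open>d \<ge> 0\<close> by (simp add: mult_le_0_iff)
  then show ?thesis using c by simp
qed

lemma psd_sym: "psd M \<Longrightarrow> x \<bullet> (M *v y) = y \<bullet> (M *v x)"
  by (metis inner_matrix_vector_left inner_commute psd_def)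

lemma psd_nonneg: "psd M \<Longrightarrow> 0 \<le> x \<bullet> (M *v x)"
  by (simp add: psd_def)

lemma psd_eq_0:
  assumes M: "psd M" and x: "x \<bullet> (M *v x) = 0"
  shows "M *v x = 0"
proof -
  let ?y = "M *v x"
  define c where "c = ?y \<bullet> ?y"
  define d where "d = ?y \<bullet> (M *v ?y)"
  have ge: "0 \<le> 2 * s * c + s\<^sup>2 * d" for s
  proof -
    have "0 \<le> (x + s *\<^sub>R ?y) \<bullet> (M *v (x + s *\<^sub>R ?y))" by (rule psd_nonneg[OF M])
    also have "\<dots> = 2 * s * c + s\<^sup>2 * d"
      using x psd_sym[OF M, of x ?y]
      by (simp add: c_def d_def algebra_simps inner_add_left inner_add_right power2_eq_square)
    finally show ?thesis .
  qed
  have "c = 0" by (rule quadratic_nonneg_imp_linear_eq_0[OF ge])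
  then show ?thesis by (simp add: c_def)
qed

lemma is_pinv_transpose:
  assumes "is_pinv M X"
  shows "is_pinv (transpose M) (transpose X)"
proof -
  have "transpose M ** transpose X ** transpose M = transpose (M ** X ** M)"
    "transpose X ** transpose M ** transpose X = transpose (X ** M ** X)"
    "transpose M ** transpose X = transpose (X ** M)"
    "transpose X ** transpose M = transpose (M ** X)"
    by (simp_all add: matrix_transpose_mul matrix_mul_assoc)
  then show ?thesis using assms by (simp add: is_pinv_def)
qed

lemma transpose_pinv: "transpose (pinv M) = pinv (transpose M)"
  by (rule is_pinv_unique[OF is_pinv_transpose[OF is_pinv_pinv] is_pinv_pinv])

lemma psd_pinv:
  assumes "psd M"
  shows "psd (pinv M)"
  unfolding psd_def
proof (intro conjI allI)
  have sym: "transpose (pinv M) = pinv M"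
    using assms by (simp add: transpose_pinv psd_def)
  then show "transpose (pinv M) = pinv M" .
  fix x
  have "pinv M *v x = pinv M *v (M *v (pinv M *v x))"
    using is_pinv_pinv[of M] by (simp add: is_pinv_def matrix_vector_mul_assoc matrix_mul_assoc)
  then have "x \<bullet> (pinv M *v x) = (pinv M *v x) \<bullet> (M *v (pinv M *v x))"
    by (metis inner_transpose_matrix_vector sym)
  then show "0 \<le> x \<bullet> (pinv M *v x)" using psd_nonneg[OF assms] by simp
qed

lemma psd_congruence: "psd M \<Longrightarrow> psd (K ** M ** transpose K)"
proof -
  assume M: "psd M"
  have "x \<bullet> ((K ** M ** transpose K) *v x) = (transpose K *v x) \<bullet> (M *v (transpose K *v x))" for x
    by (simp add: inner_transpose_matrix_vector matrix_vector_mul_assoc matrix_mul_assoc)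
  then show ?thesis
    using M by (simp add: psd_def matrix_transpose_mul matrix_mul_assoc)
qed

text \<open>
  Minimising \<open>(x + N w)' H (x + N w)\<close> over \<open>w\<close> yields a quadratic form in \<open>x\<close>, whose matrix \<open>H1\<close> is the Schur
  complement with the inverse replaced by the pseudoinverse of \<open>N' H N\<close>.  The last property exhibits a
  minimiser.  No information is lost through the pseudoinverse, because for semidefinite \<open>H\<close> the kernel
  of \<open>N' H N\<close> is contained in that of \<open>H N\<close>.
\<close>

lemma psd_schur_complement:
  fixes H :: "real^'n^'n" and N :: "real^'k^'n"
  assumes H: "psd H"
  obtains H1 where "psd H1" and "H1 ** N = 0" and "\<And>x. \<exists>w. H1 *v x = H *v (x + N *v w)"
proof -
  define K where "K = transpose N ** H ** N"
  define H1 where "H1 = H - H ** N ** pinv K ** transpose N ** H"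
  have symH: "transpose H = H" using H by (simp add: psd_def)
  have "transpose K = K"
    by (simp add: K_def matrix_transpose_mul symH matrix_mul_assoc)
  then have symK: "transpose (pinv K) = pinv K" by (simp add: transpose_pinv)
  have symH1: "transpose H1 = H1"
    by (simp add: H1_def transpose_diff matrix_transpose_mul symH symK matrix_mul_assoc)
  have ker: "H *v (N *v y) = 0" if "K *v y = 0" for y
  proof (rule psd_eq_0[OF H])
    have "(N *v y) \<bullet> (H *v (N *v y)) = y \<bullet> (K *v y)"
      by (simp add: K_def inner_matrix_vector_left matrix_vector_mul_assoc matrix_mul_assoc)
    then show "(N *v y) \<bullet> (H *v (N *v y)) = 0" using that by simp
  qed
  have H1: "H1 *v x = H *v (x + N *v (- (pinv K *v (transpose N *v (H *v x)))))" for x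
    by (simp add: H1_def algebra_simps matrix_vector_minus_right matrix_vector_mul_assoc matrix_mul_assoc)
  have H1Pr: "H1 *v (N *v x) = 0" for x
  proof -
    have "K *v (x - pinv K *v (K *v x)) = 0"
      using is_pinv_pinv[of K]
      by (simp add: is_pinv_def algebra_simps matrix_vector_mul_assoc matrix_mul_assoc)
    then have "H *v (N *v (x - pinv K *v (K *v x))) = 0" by (rule ker)
    moreover have "transpose N *v (H *v (N *v x)) = K *v x"
      by (simp add: K_def matrix_vector_mul_assoc matrix_mul_assoc)
    ultimately show ?thesis
      by (simp add: H1_def algebra_simps matrix_vector_mul_assoc[symmetric])
  qed
  have "0 \<le> x \<bullet> (H1 *v x)" for x
  proof -
    obtain w where w: "H1 *v x = H *v (x + N *v w)" using H1 by blast
    have "(N *v w) \<bullet> (H1 *v x) = 0"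
      by (metis H1Pr inner_transpose_matrix_vector inner_commute inner_zero_left symH1)
    then have "x \<bullet> (H1 *v x) = (x + N *v w) \<bullet> (H1 *v x)" by (simp add: inner_add_left)
    then show ?thesis unfolding w using psd_nonneg[OF H] by simp
  qed
  with symH1 have "psd H1" by (simp add: psd_def)
  moreover have "H1 ** N = 0" by (simp add: matrix_eq matrix_vector_mul_assoc[symmetric] H1Pr)
  ultimately show ?thesis using that H1 by blast
qed

lemma orthogonal_projection_matrix:
  fixes N :: "(real^'n) set"
  assumes N: "subspace N"
  obtains Pr :: "real^'n^'n" where "transpose Pr = Pr" and "\<And>x. Pr *v x \<in> N" and "\<And>x. x \<in> N \<Longrightarrow> Pr *v x = x"
proof -
  have "\<exists>y\<in>N. \<forall>w\<in>N. (x - y) \<bullet> w = 0" for x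
  proof -
    obtain y z where "y \<in> span N" "\<And>w. w \<in> span N \<Longrightarrow> orthogonal z w" "x = y + z"
      by (rule orthogonal_subspace_decomp_exists[of N x]) blast
    then show ?thesis
      using N by (intro bexI[of _ y]) (auto simp: orthogonal_def span_eq_iff[THEN iffD2])
  qed
  then obtain f where fN: "\<And>x. f x \<in> N" and f: "\<And>x w. w \<in> N \<Longrightarrow> (x - f x) \<bullet> w = 0"
    by metis
  have unique: "f x = y" if "y \<in> N" and "\<And>w. w \<in> N \<Longrightarrow> (x - y) \<bullet> w = 0" for x y
  proof -
    have "f x - y \<in> N" using fN that(1) N subspace_diff by blast
    then have "(f x - y) \<bullet> (f x - y) = 0"
      using f[of "f x - y" x] that(2)[of "f x - y"] by (simp add: inner_diff_left)
    then show ?thesis by simp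
  qed
  have "linear f"
  proof (rule linearI)
    show "f (x + y) = f x + f y" for x y
      using f[of _ x] f[of _ y]
      by (intro unique) (auto simp: fN N subspace_add inner_diff_left inner_add_left)
    show "f (c *\<^sub>R x) = c *\<^sub>R f x" for c x
      using f[of _ x]
      by (intro unique) (auto simp: fN N subspace_scale inner_diff_left)
  qed
  then have F: "matrix f *v x = f x" for x by (simp add: matrix_works)
  have sym: "f x \<bullet> y = x \<bullet> f y" for x y
    using f[OF fN, of x y] f[OF fN, of y x] by (simp add: inner_diff_left inner_commute[of y] inner_commute[of "f y"])
  have "transpose (matrix f) *v x = matrix f *v x" for x
  proof -
    have "(transpose (matrix f) *v x) \<bullet> y = (matrix f *v x) \<bullet> y" for y
      by (simp add: inner_transpose_matrix_vector F sym)
    then show ?thesis by (metis vector_eq_rdot)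
  qed
  then have "transpose (matrix f) = matrix f" by (simp add: matrix_eq)
  moreover have "f x = x" if "x \<in> N" for x using that by (intro unique) auto
  ultimately show ?thesis using that[of "matrix f"] F fN by auto
qed

section \<open>Linear differential equations\<close>

text \<open>
  Picard iteration.  The increments of successive iterates are measured against the weight
  \<open>exp (2 K (t - a))\<close>, where \<open>K\<close> bounds \<open>L\<close>: with this weight every iteration halves them, whatever
  the length of the interval, so the iterates converge uniformly on all of it.
\<close>

lemma affine_ode_exists_forward:
  fixes L :: "'a::euclidean_space \<Rightarrow> 'a"
  assumes L: "bounded_linear L" and g: "continuous_on {a..b} g" and "a \<le> b"
  obtains y where "y a = y0"
    and "\<And>t. t \<in> {a..b} \<Longrightarrow> (y has_vector_derivative L (y t) + g t) (at t within {a..b})"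
proof -
  obtain K where "K > 0" and K: "\<And>x. norm (L x) \<le> norm x * K"
    using bounded_linear.pos_bounded[OF L] by blast
  define \<Phi> where "\<Phi> = (\<lambda>y t. y0 + integral {a..t} (\<lambda>s. L (y s) + g s))"
  define y where "y n = (\<Phi> ^^ n) (\<lambda>_. y0)" for n
  define e where "e n t = y (Suc n) t - y n t" for n t
  have ySuc: "y (Suc n) t = y0 + integral {a..t} (\<lambda>s. L (y n s) + g s)" for n t
    by (simp add: y_def \<Phi>_def)
  have contL: "continuous_on A (\<lambda>s. L (f s))" if "continuous_on A f" for A f
    using bounded_linear.continuous_on[OF L that] .
  have cont: "continuous_on {a..b} (y n)" for n
  proof (induction n)
    case 0 show ?case by (simp add: y_def)
  next
    case (Suc n)
    have "continuous_on {a..b} (\<lambda>t. y0 + integral {a..t} (\<lambda>s. L (y n s) + g s))"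
      by (intro continuous_intros indefinite_integral_continuous_1 integrable_continuous_real
          contL Suc g)
    then show ?case by (simp add: ySuc[abs_def])
  qed
  have cont': "continuous_on {a..t} (y n)" "continuous_on {a..t} g" if "t \<in> {a..b}" for n t
    using that by (auto intro: continuous_on_subset[OF cont] continuous_on_subset[OF g])
  have cont_e: "continuous_on {a..t} (e n)" if "t \<in> {a..b}" for n t
    unfolding e_def using cont'[OF that] by (intro continuous_intros)
  have eSuc: "e (Suc n) t = integral {a..t} (\<lambda>s. L (e n s))" if t: "t \<in> {a..b}" for n t
  proof -
    have "e (Suc n) t = integral {a..t} (\<lambda>s. (L (y (Suc n) s) + g s) - (L (y n s) + g s))"
      unfolding e_def ySuc[of "Suc n" t] ySuc[of n t]
      by (subst integral_diff)
         (auto intro!: integrable_continuous_real continuous_intros contL cont'[OF t])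
    then show ?thesis
      by (simp add: e_def linear_diff[OF bounded_linear.linear[OF L]])
  qed
  obtain C where C: "\<And>t. t \<in> {a..b} \<Longrightarrow> norm (e 0 t) \<le> C" and "C > 0"
  proof -
    have "bounded (e 0 ` {a..b})"
      using cont_e[of b 0] \<open>a \<le> b\<close>
      by (auto intro!: compact_imp_bounded compact_continuous_image)
    then obtain C where "C > 0" "\<forall>x\<in>e 0 ` {a..b}. norm x \<le> C" unfolding bounded_pos by blast
    then show ?thesis using that by blast
  qed
  have bound: "norm (e n t) \<le> C * (1/2)^n * exp (2 * K * (t - a))" if "t \<in> {a..b}" for n t
    using that
  proof (induction n arbitrary: t)
    case 0
    have "C * 1 \<le> C * exp (2 * K * (t - a))"
      using 0 \<open>K > 0\<close> \<open>C > 0\<close> by (intro mult_left_mono) auto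
    then show ?case using C[OF 0] by simp
  next
    case (Suc n)
    let ?r = "\<lambda>s. K * (C * (1/2)^n * exp (2 * K * (s - a)))"
    have r: "(?r has_integral (C * (1/2)^Suc n * exp (2 * K * (t - a))
              - C * (1/2)^Suc n * exp (2 * K * (a - a)))) {a..t}"
    proof (rule fundamental_theorem_of_calculus)
      show "a \<le> t" using Suc.prems by simp
      show "((\<lambda>s. C * (1/2)^Suc n * exp (2 * K * (s - a))) has_vector_derivative ?r s)
              (at s within {a..t})" for s
        unfolding has_real_derivative_iff_has_vector_derivative[symmetric]
        by (rule derivative_eq_intros refl | simp)+
    qed
    have "norm (e (Suc n) t) \<le> integral {a..t} ?r"
      unfolding eSuc[OF Suc.prems]
    proof (rule integral_norm_bound_integral)
      show "(\<lambda>s. L (e n s)) integrable_on {a..t}"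
        by (intro integrable_continuous_real contL cont_e Suc.prems)
      show "?r integrable_on {a..t}" using r by blast
      show "norm (L (e n s)) \<le> ?r s" if "s \<in> {a..t}" for s
      proof -
        have "norm (e n s) \<le> C * (1/2)^n * exp (2 * K * (s - a))"
          using Suc.prems that by (intro Suc.IH) auto
        then have "norm (e n s) * K \<le> C * (1/2)^n * exp (2 * K * (s - a)) * K"
          using \<open>K > 0\<close> by (intro mult_right_mono) auto
        then show ?thesis
          using K[of "e n s"] by (simp only: mult.commute[of K])
      qed
    qed
    also have "\<dots> \<le> C * (1/2)^Suc n * exp (2 * K * (t - a))"
      using integral_unique[OF r] \<open>C > 0\<close> by simp
    finally show ?case .
  qed
  have yn: "y n t = y0 + (\<Sum>i<n. e i t)" for n t
    by (induction n) (simp_all add: e_def y_def)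
  define z where "z t = y0 + suminf (\<lambda>i. e i t)" for t
  have "uniform_limit {a..b} (\<lambda>n t. \<Sum>i<n. e i t) (\<lambda>t. suminf (\<lambda>i. e i t)) sequentially"
  proof (rule Weierstrass_m_test)
    show "norm (e n t) \<le> C * exp (2 * K * (b - a)) * (1/2)^n" if "t \<in> {a..b}" for n t
    proof -
      have "C * (1/2)^n * exp (2 * K * (t - a)) \<le> C * (1/2)^n * exp (2 * K * (b - a))"
        using that \<open>K > 0\<close> \<open>C > 0\<close> by (intro mult_left_mono) auto
      then show ?thesis using bound[OF that, of n] by (simp add: mult_ac)
    qed
    show "summable (\<lambda>n. C * exp (2 * K * (b - a)) * (1/2)^n)"
      by (intro summable_mult summable_geometric) simp
  qed
  then have ul: "uniform_limit {a..b} y z sequentially"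
    unfolding z_def[abs_def] yn[abs_def] by (intro uniform_limit_intros) auto
  have contz: "continuous_on {a..b} z"
    by (rule uniform_limit_theorem[OF _ ul]) (auto simp: cont)
  have z: "z t = y0 + integral {a..t} (\<lambda>s. L (z s) + g s)" if t: "t \<in> {a..b}" for t
  proof -
    have "uniform_limit {a..t} y z sequentially"
      by (rule uniform_limit_on_subset[OF ul]) (use t in auto)
    then have "uniform_limit {a..t} (\<lambda>n s. L (y n s) + g s) (\<lambda>s. L (z s) + g s) sequentially"
      by (intro uniform_limit_intros bounded_linear.uniform_limit[OF L])
    then obtain I J where I: "\<And>n. ((\<lambda>s. L (y n s) + g s) has_integral I n) {a..t}"
      and J: "((\<lambda>s. L (z s) + g s) has_integral J) {a..t}" and IJ: "I \<longlonglongrightarrow> J"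
      by (rule uniform_limit_integral)
         (auto intro!: continuous_intros contL cont'[OF t])
    have "(\<lambda>n. y (Suc n) t) \<longlonglongrightarrow> y0 + J"
      unfolding ySuc integral_unique[OF I] by (intro tendsto_intros IJ)
    moreover have "(\<lambda>n. y (Suc n) t) \<longlonglongrightarrow> z t"
      using tendsto_uniform_limitI[OF ul t] by (rule LIMSEQ_Suc)
    ultimately show ?thesis
      using LIMSEQ_unique integral_unique[OF J] by blast
  qed
  show ?thesis
  proof
    show "z a = y0" using z[of a] \<open>a \<le> b\<close> by simp
    fix t assume t: "t \<in> {a..b}"
    have "((\<lambda>t. y0 + integral {a..t} (\<lambda>s. L (z s) + g s)) has_vector_derivative
           0 + (L (z t) + g t)) (at t within {a..b})"
      by (intro has_vector_derivative_add has_vector_derivative_const integral_has_vector_derivative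
          continuous_intros contL contz g t)
    then show "(z has_vector_derivative L (z t) + g t) (at t within {a..b})"
      using has_vector_derivative_transform[OF t z] by simp
  qed
qed

text \<open>
  Costates and Riccati solutions are prescribed at the right end of the interval; time reversal reduces
  them to the previous lemma.
\<close>

lemma affine_ode_exists_backward:
  fixes L :: "'a::euclidean_space \<Rightarrow> 'a"
  assumes L: "bounded_linear L" and g: "continuous_on {a..b} g" and "a \<le> b"
  obtains y where "y b = y0"
    and "\<And>t. t \<in> {a..b} \<Longrightarrow> (y has_vector_derivative L (y t) + g t) (at t within {a..b})"
proof -
  let ?r = "\<lambda>t. a + b - t"
  have "continuous_on {a..b} (\<lambda>t. - g (?r t))"
    by (intro continuous_intros continuous_on_compose2[OF g]) auto
  then obtain y where y: "y a = y0"
    "\<And>t. t \<in> {a..b} \<Longrightarrow> (y has_vector_derivative - L (y t) + - g (?r t)) (at t within {a..b})"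
    by (rule affine_ode_exists_forward[OF bounded_linear_minus[OF L] _ \<open>a \<le> b\<close>, of _ y0]) blast
  show ?thesis
  proof (rule that[of "y \<circ> ?r"])
    show "(y \<circ> ?r) b = y0" using y by simp
    fix t assume t: "t \<in> {a..b}"
    have im: "?r ` {a..b} = {a..b}"
      by auto
    have "(?r has_vector_derivative -1) (at t within {a..b})"
      by (auto intro!: derivative_eq_intros)
    moreover have "(y has_vector_derivative - L (y (?r t)) + - g (?r (?r t))) (at (?r t) within ?r ` {a..b})"
      unfolding im by (rule y) (use t in auto)
    ultimately have "(y \<circ> ?r has_vector_derivative (-1) *\<^sub>R (- L (y (?r t)) + - g (?r (?r t)))) (at t within {a..b})"
      by (rule vector_diff_chain_within)
    then show "(y \<circ> ?r has_vector_derivative L ((y \<circ> ?r) t) + g t) (at t within {a..b})"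
      by (simp add: add.commute)
  qed
qed

text \<open>
  Uniqueness for linear equations, in both directions of time: multiplied by \<open>exp (- 2 K t)\<close> the function
  \<open>t \<mapsto> f t \<bullet> f t\<close> decreases, multiplied by \<open>exp (2 K t)\<close> it increases.
\<close>

lemma gronwall_zero:
  fixes f :: "real \<Rightarrow> 'a::real_inner"
  assumes d: "\<And>t. t \<in> {a..b} \<Longrightarrow> (f has_vector_derivative f' t) (at t within {a..b})"
    and bd: "\<And>t. t \<in> {a..b} \<Longrightarrow> norm (f' t) \<le> K * norm (f t)"
    and c: "c \<in> {a..b}" "f c = 0" and t: "t \<in> {a..b}"
  shows "f t = 0"
proof -
  define \<phi> where "\<phi> = (\<lambda>\<sigma> t. exp (\<sigma> * t) * (f t \<bullet> f t))"
  \<comment> \<open>\<open>\<phi>' \<sigma>\<close> is the derivative of \<open>\<phi> \<sigma>\<close>; the sign of \<open>\<sigma>\<close> is chosen according to the direction of time.\<close>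
  define \<phi>' where "\<phi>' = (\<lambda>\<sigma> t. exp (\<sigma> * t) * (\<sigma> * (f t \<bullet> f t) + 2 * (f t \<bullet> f' t)))"
  have d\<phi>: "(\<phi> \<sigma> has_derivative (\<lambda>h. h * \<phi>' \<sigma> s)) (at s within A)"
    if "s \<in> {a..b}" "A \<subseteq> {a..b}" for \<sigma> s A
  proof -
    have "(f has_derivative (\<lambda>h. h *\<^sub>R f' s)) (at s within A)"
      using d[OF that(1)] that(2) has_derivative_subset unfolding has_vector_derivative_def by blast
    then show ?thesis
      unfolding \<phi>_def \<phi>'_def
      by (auto intro!: derivative_eq_intros simp: inner_commute algebra_simps)
  qed
  have key: "\<bar>2 * (f s \<bullet> f' s)\<bar> \<le> 2 * K * (f s \<bullet> f s)" if "s \<in> {a..b}" for s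
  proof -
    have "\<bar>f s \<bullet> f' s\<bar> \<le> norm (f s) * norm (f' s)" by (rule Cauchy_Schwarz_ineq2)
    also have "\<dots> \<le> norm (f s) * (K * norm (f s))" by (intro mult_left_mono bd that) simp
    finally show ?thesis by (simp add: dot_square_norm power2_eq_square algebra_simps)
  qed
  have "\<phi> \<sigma> t \<le> 0" if "\<sigma> = (if c \<le> t then - 2 * K else 2 * K)" for \<sigma>
  proof (cases "c \<le> t")
    case True
    then obtain s where s: "s \<in> {c..t}" "\<phi> \<sigma> t - \<phi> \<sigma> c = (t - c) * \<phi>' \<sigma> s"
      using mvt_very_simple[of c t "\<phi> \<sigma>" "\<lambda>s h. h * \<phi>' \<sigma> s"] d\<phi> c t by fastforce
    have "\<phi>' \<sigma> s \<le> 0"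
      unfolding \<phi>'_def using key[of s] s c t that True by (intro mult_nonneg_nonpos) auto
    then have "(t - c) * \<phi>' \<sigma> s \<le> 0" using True by (intro mult_nonneg_nonpos) auto
    then show ?thesis using s c by (simp add: \<phi>_def)
  next
    case False
    then obtain s where s: "s \<in> {t..c}" "\<phi> \<sigma> c - \<phi> \<sigma> t = (c - t) * \<phi>' \<sigma> s"
      using mvt_very_simple[of t c "\<phi> \<sigma>" "\<lambda>s h. h * \<phi>' \<sigma> s"] d\<phi> c t by fastforce
    have "\<phi>' \<sigma> s \<ge> 0"
      unfolding \<phi>'_def using key[of s] s c t that False by (intro mult_nonneg_nonneg) auto
    then have "(c - t) * \<phi>' \<sigma> s \<ge> 0" using False by (intro mult_nonneg_nonneg) auto
    then show ?thesis using s c by (simp add: \<phi>_def)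
  qed
  then have "exp ((if c \<le> t then - 2 * K else 2 * K) * t) * (f t \<bullet> f t) \<le> 0"
    by (simp add: \<phi>_def)
  then have "f t \<bullet> f t \<le> 0" by (simp add: mult_le_0_iff)
  then show ?thesis using inner_ge_zero[of "f t"] inner_eq_zero_iff[of "f t"] by linarith
qed

section \<open>Differentiating products with an indefinite integral\<close>

text \<open>
  Integration by parts in which one factor is only an indefinite integral, hence in general not
  everywhere differentiable; this is the situation for states driven by square-integrable controls.
  Instead of derivatives almost everywhere the proof compares the increments of \<open>h (p t) (y t)\<close> and of the
  integral over short intervals: they differ by at most \<open>\<epsilon>\<close> times the increment of the integral of
  \<open>1 + norm (g s)\<close>, and such bounds add up over adjacent intervals.
\<close>

lemma has_integral_product_rule:
  fixes h :: "'a::euclidean_space \<Rightarrow> 'b::euclidean_space \<Rightarrow> 'c::euclidean_space"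
  assumes h: "bounded_bilinear h" and "a \<le> b"
    and p: "\<And>t. t \<in> {a..b} \<Longrightarrow> (p has_vector_derivative p' t) (at t within {a..b})"
    and p': "continuous_on {a..b} p'"
    and y: "\<And>t. t \<in> {a..b} \<Longrightarrow> (g has_integral (y t - y a)) {a..t}"
    and g: "g absolutely_integrable_on {a..b}"
  shows "((\<lambda>t. h (p' t) (y t) + h (p t) (g t)) has_integral (h (p b) (y b) - h (p a) (y a))) {a..b}"
proof -
  interpret bounded_bilinear h by (rule h)
  have gi: "g integrable_on {a..b}" and ngi: "(\<lambda>s. norm (g s)) integrable_on {a..b}"
    using g by (auto simp: absolutely_integrable_on_def)
  have contp: "continuous_on {a..b} p"
    using p by (rule continuous_on_vector_derivative)
  have conty: "continuous_on {a..b} y"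
  proof -
    have "continuous_on {a..b} (\<lambda>t. y a + integral {a..t} g)"
      by (intro continuous_intros indefinite_integral_continuous_1 gi)
    moreover have "y a + integral {a..t} g = y t" if "t \<in> {a..b}" for t
      using integral_unique[OF y[OF that]] by simp
    ultimately show ?thesis using continuous_on_cong by (metis (no_types, lifting))
  qed
  define \<phi> where "\<phi> t = h (p' t) (y t) + h (p t) (g t)" for t
  have "(\<lambda>t. h (p t) (g t)) absolutely_integrable_on {a..b}"
    by (rule absolutely_integrable_bounded_measurable_product[OF _ _ _ _ g])
       (auto simp: bilinear_conv_bounded_bilinear h
             intro!: continuous_imp_measurable_on_sets_lebesgue contp compact_imp_bounded
               compact_continuous_image)
  then have "(\<lambda>t. h (p t) (g t)) integrable_on {a..b}"
    by (rule set_lebesgue_integral_eq_integral(1))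
  moreover have "(\<lambda>t. h (p' t) (y t)) integrable_on {a..b}"
    by (intro integrable_continuous_real continuous_on p' conty)
  ultimately have \<phi>i: "\<phi> integrable_on {a..b}"
    unfolding \<phi>_def[abs_def] by (intro integrable_add)
  define D where "D t = h (p t) (y t) - integral {a..t} \<phi>" for t
  define W where "W t = integral {a..t} (\<lambda>s. 1 + norm (g s))" for t
  have Wi: "(\<lambda>s. 1 + norm (g s)) integrable_on {a..b}"
    by (intro integrable_add ngi) auto
  obtain K where "K > 0" and K: "\<And>u v. norm (h u v) \<le> norm u * norm v * K"
    using pos_bounded by blast
  obtain M where "M > 0" and M: "\<And>t. t \<in> {a..b} \<Longrightarrow> norm (p' t) \<le> M"
  proof -
    have "bounded (p' ` {a..b})" by (auto intro!: compact_imp_bounded compact_continuous_image p')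
    then obtain C where "C > 0" "\<forall>x\<in>p' ` {a..b}. norm x \<le> C" unfolding bounded_pos by blast
    then show ?thesis using that by blast
  qed
  \<comment> \<open>The estimate passes from adjacent intervals to their union and holds for all short
    intervals around a given point, hence on the whole interval.\<close>
  have main: "norm (D b - D a) \<le> \<epsilon> * (W b - W a)" if "\<epsilon> > 0" for \<epsilon>
  proof -
    define G where "G s t \<longleftrightarrow> a \<le> s \<longrightarrow> t \<le> b \<longrightarrow> norm (D t - D s) \<le> \<epsilon> * (W t - W s)" for s t
    from \<open>a \<le> b\<close> have "G a b"
    proof (induction a b rule: Bolzano)
      case (trans r s t)
      then show ?case
        using norm_triangle_ineq[of "D t - D s" "D s - D r"] by (auto simp: G_def algebra_simps)
    next
      case (local x)
      \<comment> \<open>\<open>2 \<eta>\<close> bounds the oscillation of \<open>p\<close> and \<open>y\<close> near \<open>x\<close>; it has to absorb the bound \<open>K\<close> of \<open>h\<close> and the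
        bound \<open>M\<close> of \<open>p'\<close>.\<close>
      define \<eta> where "\<eta> = \<epsilon> / (2 * K * (M + 1))"
      have "\<eta> > 0" using \<open>K > 0\<close> \<open>M > 0\<close> \<open>\<epsilon> > 0\<close> by (simp add: \<eta>_def)
      have "\<eta> * (2 * K * (M + 1)) = \<epsilon>" using \<open>K > 0\<close> \<open>M > 0\<close> by (simp add: \<eta>_def)
      moreover have "0 \<le> M * (2 * \<eta>) * K" "0 \<le> 2 * \<eta> * K"
        using \<open>K > 0\<close> \<open>M > 0\<close> \<open>\<eta> > 0\<close> by auto
      ultimately have \<eta>: "M * (2 * \<eta>) * K \<le> \<epsilon>" "2 * \<eta> * K \<le> \<epsilon>"
        by (auto simp: algebra_simps)
      have x: "x \<in> {a..b}" using local by simp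
      obtain d1 where "d1 > 0" and d1: "\<And>r. r \<in> {a..b} \<Longrightarrow> dist r x < d1 \<Longrightarrow> dist (p r) (p x) < \<eta>"
        using contp x \<open>\<eta> > 0\<close> unfolding continuous_on_iff by blast
      obtain d2 where "d2 > 0" and d2: "\<And>r. r \<in> {a..b} \<Longrightarrow> dist r x < d2 \<Longrightarrow> dist (y r) (y x) < \<eta>"
        using conty x \<open>\<eta> > 0\<close> unfolding continuous_on_iff by blast
      have "norm (D t - D s) \<le> \<epsilon> * (W t - W s)"
        if st: "s \<le> x" "x \<le> t" "t - s < min d1 d2" "a \<le> s" "t \<le> b" for s t
      proof -
        have sub: "{s..t} \<subseteq> {a..b}" and "s \<le> t" using st by auto
        have near: "norm (p s - p r) \<le> 2 * \<eta>" "norm (y t - y r) \<le> 2 * \<eta>" if "r \<in> {s..t}" for r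
        proof -
          have "dist (p s) (p x) < \<eta>" "dist (p r) (p x) < \<eta>"
            "dist (y t) (y x) < \<eta>" "dist (y r) (y x) < \<eta>"
            using st that by (auto intro!: d1 d2 simp: dist_real_def)
          then show "norm (p s - p r) \<le> 2 * \<eta>" "norm (y t - y r) \<le> 2 * \<eta>"
            using dist_triangle2[of "p s" "p r" "p x"] dist_triangle2[of "y t" "y r" "y x"]
            by (auto simp: dist_norm)
        qed
        have inc: "integral {a..t} f - integral {a..s} f = integral {s..t} f"
          if "f integrable_on {a..b}" for f :: "real \<Rightarrow> 'd::banach"
          using Henstock_Kurzweil_Integration.integral_combine[of a s t f] st
            integrable_on_subinterval[OF that, of a t] by (simp add: algebra_simps)
        have gst: "(g has_integral (y t - y s)) {s..t}"
        proof -
          have "integral {s..t} g = y t - y s"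
            using inc[OF gi] integral_unique[OF y[of t]] integral_unique[OF y[of s]] st by simp
          moreover have "g integrable_on {s..t}" using integrable_on_subinterval[OF gi sub] .
          ultimately show ?thesis by (metis integrable_integral)
        qed
        have "(p' has_integral (p t - p s)) {s..t}"
          using \<open>s \<le> t\<close> sub
          by (intro fundamental_theorem_of_calculus)
             (auto intro!: has_vector_derivative_within_subset[OF p])
        from has_integral_linear[OF this bounded_linear_left[of "y t"]]
        have 1: "((\<lambda>r. h (p' r) (y t)) has_integral h (p t - p s) (y t)) {s..t}" by (simp add: o_def)
        from has_integral_linear[OF gst bounded_linear_right[of "p s"]]
        have 2: "((\<lambda>r. h (p s) (g r)) has_integral h (p s) (y t - y s)) {s..t}" by (simp add: o_def)
        have 3: "(\<phi> has_integral integral {s..t} \<phi>) {s..t}"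
          using integrable_on_subinterval[OF \<phi>i sub] by (rule integrable_integral)
        have "h (p t - p s) (y t) + h (p s) (y t - y s) - integral {s..t} \<phi> = D t - D s"
          using inc[OF \<phi>i] by (simp add: D_def diff_left diff_right algebra_simps)
        moreover have "h (p' r) (y t) + h (p s) (g r) - \<phi> r = h (p' r) (y t - y r) + h (p s - p r) (g r)" for r
          by (simp add: \<phi>_def diff_left diff_right algebra_simps)
        ultimately have 4: "((\<lambda>r. h (p' r) (y t - y r) + h (p s - p r) (g r)) has_integral (D t - D s)) {s..t}"
          using has_integral_diff[OF has_integral_add[OF 1 2] 3] by simp
        have "norm (D t - D s) \<le> integral {s..t} (\<lambda>r. \<epsilon> * (1 + norm (g r)))"
          unfolding integral_unique[OF 4, symmetric]
        proof (rule Henstock_Kurzweil_Integration.integral_norm_bound_integral)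
          show "(\<lambda>r. h (p' r) (y t - y r) + h (p s - p r) (g r)) integrable_on {s..t}" using 4 by blast
          show "(\<lambda>r. \<epsilon> * (1 + norm (g r))) integrable_on {s..t}"
            by (rule integrable_on_subinterval[OF _ sub]) (intro integrable_on_mult_right Wi)
          fix r assume r: "r \<in> {s..t}"
          have "norm (h (p' r) (y t - y r)) \<le> norm (p' r) * norm (y t - y r) * K" by (rule K)
          also have "\<dots> \<le> M * (2 * \<eta>) * K"
            using M[of r] near(2)[OF r] r sub \<open>K > 0\<close> \<open>M > 0\<close> by (intro mult_right_mono mult_mono) auto
          also note \<eta>(1)
          finally have a: "norm (h (p' r) (y t - y r)) \<le> \<epsilon>" .
          have "norm (h (p s - p r) (g r)) \<le> norm (p s - p r) * norm (g r) * K" by (rule K)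
          also have "\<dots> \<le> 2 * \<eta> * norm (g r) * K"
            using near(1)[OF r] \<open>K > 0\<close> by (intro mult_right_mono) auto
          also have "\<dots> = 2 * \<eta> * K * norm (g r)" by simp
          also have "\<dots> \<le> \<epsilon> * norm (g r)" by (intro mult_right_mono \<eta>(2)) auto
          finally have b: "norm (h (p s - p r) (g r)) \<le> \<epsilon> * norm (g r)" .
          show "norm (h (p' r) (y t - y r) + h (p s - p r) (g r)) \<le> \<epsilon> * (1 + norm (g r))"
            using norm_triangle_mono[OF a b] by (simp add: algebra_simps)
        qed
        also have "\<dots> = \<epsilon> * (W t - W s)"
          unfolding W_def inc[OF Wi] by simp
        finally show ?thesis .
      qed
      then show ?case
        using \<open>d1 > 0\<close> \<open>d2 > 0\<close> by (intro exI[of _ "min d1 d2"]) (auto simp: G_def)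
    qed
    then show ?thesis by (simp add: G_def)
  qed
  have "D b = D a"
  proof (rule ccontr)
    assume "D b \<noteq> D a"
    then have pos: "norm (D b - D a) > 0" by simp
    define C where "C = \<bar>W b - W a\<bar> + 1"
    have C: "C > 0" "W b - W a \<le> C" by (auto simp: C_def)
    have "norm (D b - D a) \<le> norm (D b - D a) / (2 * C) * (W b - W a)"
      by (rule main) (use pos C in auto)
    also have "\<dots> \<le> norm (D b - D a) / (2 * C) * C"
      using C by (intro mult_left_mono) auto
    also have "\<dots> = norm (D b - D a) / 2" using C by simp
    finally show False using pos by simp
  qed
  then have "integral {a..b} \<phi> = h (p b) (y b) - h (p a) (y a)"
    by (simp add: D_def algebra_simps)
  then show ?thesis using integrable_integral[OF \<phi>i] by (simp add: \<phi>_def[abs_def])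
qed

section \<open>Square-integrable controls and the cost form\<close>

lemma square_integrableI_bound:
  assumes "f \<in> borel_measurable (lebesgue_on {t0..T})" and "g integrable_on {t0..T}"
    and "\<And>t. t \<in> {t0..T} \<Longrightarrow> (norm (f t))\<^sup>2 \<le> g t"
  shows "square_integrable t0 T f"
proof -
  have "(\<lambda>t. (norm (f t))\<^sup>2) absolutely_integrable_on {t0..T}"
    using assms
    by (intro measurable_bounded_by_integrable_imp_absolutely_integrable[of _ _ g]) auto
  then show ?thesis
    using assms(1) unfolding square_integrable_def
    by (auto intro: absolutely_integrable_imp_integrable)
qed

lemma square_integrable_measurable:
  "square_integrable t0 T u \<Longrightarrow> u \<in> borel_measurable (lebesgue_on {t0..T})"
  by (simp add: square_integrable_def)

lemma square_integrable_norm_sq: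
  "square_integrable t0 T u \<Longrightarrow> (\<lambda>t. (norm (u t))\<^sup>2) integrable_on {t0..T}"
  unfolding square_integrable_def by (auto intro: integrable_on_lebesgue_on)

lemma square_integrable_add:
  assumes u: "square_integrable t0 T u" and v: "square_integrable t0 T v"
  shows "square_integrable t0 T (\<lambda>t. u t + v t)"
proof (rule square_integrableI_bound)
  show "(\<lambda>t. u t + v t) \<in> borel_measurable (lebesgue_on {t0..T})"
    using u v by (intro borel_measurable_add square_integrable_measurable)
  show "(\<lambda>t. 2 * (norm (u t))\<^sup>2 + 2 * (norm (v t))\<^sup>2) integrable_on {t0..T}"
    using u v by (intro integrable_add integrable_on_mult_right square_integrable_norm_sq)
  show "(norm (u t + v t))\<^sup>2 \<le> 2 * (norm (u t))\<^sup>2 + 2 * (norm (v t))\<^sup>2" for t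
  proof -
    have "(norm (u t + v t))\<^sup>2 \<le> (norm (u t) + norm (v t))\<^sup>2"
      by (intro power_mono norm_triangle_ineq) auto
    then show ?thesis
      using sum_squares_bound[of "norm (u t)" "norm (v t)"] by (simp add: power2_sum)
  qed
qed

lemma square_integrable_matrix_vector:
  assumes u: "square_integrable t0 T u"
  shows "square_integrable t0 T (\<lambda>t. M *v u t)"
proof -
  obtain K where K: "\<And>x. norm (M *v x) \<le> norm x * K"
    using bounded_linear.bounded[OF matrix_vector_mul_bounded_linear] by blast
  show ?thesis
  proof (rule square_integrableI_bound)
    show "(\<lambda>t. M *v u t) \<in> borel_measurable (lebesgue_on {t0..T})"
      using square_integrable_measurable[OF u]
      by (rule borel_measurable_continuous_on[rotated])
         (simp add: linear_continuous_on matrix_vector_mul_bounded_linear)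
    show "(\<lambda>t. (norm (u t))\<^sup>2 * K\<^sup>2) integrable_on {t0..T}"
      by (intro integrable_on_mult_left square_integrable_norm_sq u)
    show "(norm (M *v u t))\<^sup>2 \<le> (norm (u t))\<^sup>2 * K\<^sup>2" for t
      using power_mono[OF K[of "u t"], of 2] by (simp add: power_mult_distrib)
  qed
qed

lemma square_integrable_scaleR:
  assumes "square_integrable t0 T u"
  shows "square_integrable t0 T (\<lambda>t. c *\<^sub>R u t)"
proof -
  have "(\<lambda>t. c *\<^sub>R u t) = (\<lambda>t. (c *\<^sub>R mat 1) *v u t)"
    by (simp add: scaleR_matrix_vector_assoc[symmetric])
  then show ?thesis using square_integrable_matrix_vector[OF assms] by simp
qed

lemma square_integrable_continuous:
  assumes "continuous_on {t0..T} u"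
  shows "square_integrable t0 T u"
  by (rule square_integrableI_bound[where g = "\<lambda>t. (norm (u t))\<^sup>2"])
     (use assms in \<open>auto intro!: continuous_imp_measurable_on_sets_lebesgue
        integrable_continuous_real continuous_intros\<close>)

lemma square_integrable_inner:
  assumes u: "square_integrable t0 T u" and v: "square_integrable t0 T v"
  shows "(\<lambda>t. u t \<bullet> v t) integrable_on {t0..T}"
proof -
  have "(\<lambda>t. u t \<bullet> v t) absolutely_integrable_on {t0..T}"
  proof (rule measurable_bounded_by_integrable_imp_absolutely_integrable)
    show "(\<lambda>t. u t \<bullet> v t) \<in> borel_measurable (lebesgue_on {t0..T})"
      using u v by (intro borel_measurable_inner square_integrable_measurable)
    show "(\<lambda>t. (norm (u t))\<^sup>2 + (norm (v t))\<^sup>2) integrable_on {t0..T}"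
      using u v by (intro integrable_add square_integrable_norm_sq)
    show "norm (u t \<bullet> v t) \<le> (norm (u t))\<^sup>2 + (norm (v t))\<^sup>2" for t
      using Cauchy_Schwarz_ineq2[of "u t" "v t"] sum_squares_bound[of "norm (u t)" "norm (v t)"]
        mult_nonneg_nonneg[of "norm (u t)" "norm (v t)"]
      by simp
  qed auto
  then show ?thesis by (rule set_lebesgue_integral_eq_integral(1))
qed

lemma square_integrable_absolutely_integrable:
  assumes u: "square_integrable t0 T u"
  shows "u absolutely_integrable_on {t0..T}"
proof (rule measurable_bounded_by_integrable_imp_absolutely_integrable)
  show "(\<lambda>t. 1 + (norm (u t))\<^sup>2) integrable_on {t0..T}"
    by (intro integrable_add square_integrable_norm_sq u) auto
  show "norm (u t) \<le> 1 + (norm (u t))\<^sup>2" for t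
    using sum_squares_bound[of "norm (u t)" 1] norm_ge_zero[of "u t"]
    by (simp del: norm_ge_zero)
qed (use u in \<open>auto intro: square_integrable_measurable\<close>)

lemma solves_linear_ode_initial:
  assumes "solves_linear_ode F G t0 T x0 u x" and "t0 \<le> T"
  shows "x t0 = x0"
proof -
  have "((\<lambda>s. F s *v x s + G *v u s) has_integral (x t0 - x0)) {t0..t0}"
    using assms unfolding solves_linear_ode_def by (meson atLeastAtMost_iff order_refl)
  then show ?thesis
    using has_integral_unique[OF _ has_integral_refl(2)[of _ t0]] by fastforce
qed

lemma solves_linear_ode_continuous:
  assumes x: "solves_linear_ode F G t0 T x0 u x" and "t0 \<le> T"
  shows "continuous_on {t0..T} x"
proof -
  let ?f = "\<lambda>s. F s *v x s + G *v u s"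
  have x': "(?f has_integral (x t - x0)) {t0..t}" if "t \<in> {t0..T}" for t
    using x that by (auto simp: solves_linear_ode_def)
  have "?f integrable_on {t0..T}" using x'[of T] \<open>t0 \<le> T\<close> by auto
  then have "continuous_on {t0..T} (\<lambda>t. x0 + integral {t0..t} ?f)"
    by (intro continuous_intros indefinite_integral_continuous_1)
  moreover have "x0 + integral {t0..t} ?f = x t" if "t \<in> {t0..T}" for t
    using integral_unique[OF x'[OF that]] by simp
  ultimately show ?thesis using continuous_on_cong by (metis (no_types, lifting))
qed

lemma solves_linear_ode_combine:
  assumes "solves_linear_ode F G t0 T x0 u x" and "solves_linear_ode F G t0 T y0 v y"
  shows "solves_linear_ode F G t0 T (x0 + s *\<^sub>R y0) (\<lambda>t. u t + s *\<^sub>R v t) (\<lambda>t. x t + s *\<^sub>R y t)"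
  unfolding solves_linear_ode_def
proof
  fix t assume t: "t \<in> {t0..T}"
  have "((\<lambda>r. (F r *v x r + G *v u r) + s *\<^sub>R (F r *v y r + G *v v r)) has_integral
      ((x t - x0) + s *\<^sub>R (y t - y0))) {t0..t}"
    using assms t by (intro has_integral_add has_integral_cmul) (auto simp: solves_linear_ode_def)
  then show "((\<lambda>r. F r *v (x r + s *\<^sub>R y r) + G *v (u r + s *\<^sub>R v r)) has_integral
      (x t + s *\<^sub>R y t - (x0 + s *\<^sub>R y0))) {t0..t}"
    by (simp add: algebra_simps)
qed

lemma solves_linear_odeI_derivative:
  assumes "\<And>t. t \<in> {t0..T} \<Longrightarrow> (x has_vector_derivative F t *v x t + G *v u t) (at t within {t0..T})"
    and "x t0 = x0"
  shows "solves_linear_ode F G t0 T x0 u x"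
  unfolding solves_linear_ode_def
proof
  fix t assume t: "t \<in> {t0..T}"
  have "((\<lambda>s. F s *v x s + G *v u s) has_integral (x t - x t0)) {t0..t}"
    by (rule fundamental_theorem_of_calculus)
       (use t in \<open>auto intro!: has_vector_derivative_within_subset[OF assms(1)]\<close>)
  then show "((\<lambda>s. F s *v x s + G *v u s) has_integral (x t - x0)) {t0..t}"
    by (simp add: assms(2))
qed

lemma lq_admissible_combine:
  assumes "lq_admissible A B t0 T x0 x u" and "lq_admissible A B t0 T y0 y v"
  shows "lq_admissible A B t0 T (x0 + s *\<^sub>R y0) (\<lambda>t. x t + s *\<^sub>R y t) (\<lambda>t. u t + s *\<^sub>R v t)"
  using assms unfolding lq_admissible_def
  by (auto intro!: solves_linear_ode_combine square_integrable_add square_integrable_scaleR)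

lemma lq_admissible_square_integrable:
  assumes "lq_admissible A B t0 T x0 x u" and "t0 \<le> T"
  shows "square_integrable t0 T x" and "square_integrable t0 T u"
  using assms
  by (auto simp: lq_admissible_def intro!: square_integrable_continuous solves_linear_ode_continuous)

text \<open>
  The polar form of the cost.  It is bilinear on admissible pairs, and twice its value at \<open>(x, u)\<close> and
  \<open>(y, v)\<close> is the first variation of the cost at \<open>(x, u)\<close> in direction \<open>(y, v)\<close>.
\<close>

definition lq_polar ::
  "real^'n^'n \<Rightarrow> real^'m^'m \<Rightarrow> real^'n^'n \<Rightarrow> real \<Rightarrow> real \<Rightarrow>
   (real \<Rightarrow> real^'n) \<Rightarrow> (real \<Rightarrow> real^'m) \<Rightarrow> (real \<Rightarrow> real^'n) \<Rightarrow> (real \<Rightarrow> real^'m) \<Rightarrow> real" where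
  "lq_polar Q R H t0 T x u y v =
     integral {t0..T} (\<lambda>t. x t \<bullet> (Q *v y t) + u t \<bullet> (R *v v t)) + x T \<bullet> (H *v y T)"

lemma lq_cost_eq_polar: "lq_cost Q R H t0 T x u = lq_polar Q R H t0 T x u x u"
  by (simp add: lq_cost_def lq_polar_def)

lemma lq_polar_integrable:
  assumes "lq_admissible A B t0 T x0 x u" and "lq_admissible A' B' t0 T y0 y v" and "t0 \<le> T"
  shows "(\<lambda>t. x t \<bullet> (Q *v y t) + u t \<bullet> (R *v v t)) integrable_on {t0..T}"
  using assms
  by (intro integrable_add square_integrable_inner square_integrable_matrix_vector)
     (auto intro: lq_admissible_square_integrable)

lemma lq_polar_combine:
  assumes z: "lq_admissible A B t0 T z0 z w" and x: "lq_admissible A B t0 T x0 x u"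
    and y: "lq_admissible A B t0 T y0 y v" and "t0 \<le> T"
  shows "lq_polar Q R H t0 T z w (\<lambda>t. x t + s *\<^sub>R y t) (\<lambda>t. u t + s *\<^sub>R v t) =
    lq_polar Q R H t0 T z w x u + s * lq_polar Q R H t0 T z w y v"
proof -
  have "integral {t0..T} (\<lambda>t. z t \<bullet> (Q *v (x t + s *\<^sub>R y t)) + w t \<bullet> (R *v (u t + s *\<^sub>R v t))) =
    integral {t0..T} (\<lambda>t. (z t \<bullet> (Q *v x t) + w t \<bullet> (R *v u t)) +
      s * (z t \<bullet> (Q *v y t) + w t \<bullet> (R *v v t)))"
    by (simp add: algebra_simps inner_add_right)
  also have "\<dots> = integral {t0..T} (\<lambda>t. z t \<bullet> (Q *v x t) + w t \<bullet> (R *v u t)) +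
      s * integral {t0..T} (\<lambda>t. z t \<bullet> (Q *v y t) + w t \<bullet> (R *v v t))"
    using assms
    by (subst integral_add) (auto intro!: integrable_on_mult_right lq_polar_integrable)
  finally show ?thesis by (simp add: lq_polar_def algebra_simps inner_add_right)
qed

lemma lq_polar_commute:
  assumes "psd Q" "psd R" "psd H"
  shows "lq_polar Q R H t0 T x u y v = lq_polar Q R H t0 T y v x u"
  unfolding lq_polar_def
    psd_sym[OF assms(1), of "x _" "y _"] psd_sym[OF assms(2), of "u _" "v _"]
    psd_sym[OF assms(3), of "x T" "y T"] ..

lemma lq_cost_combine:
  assumes psd: "psd Q" "psd R" "psd H" and x: "lq_admissible A B t0 T x0 x u"
    and y: "lq_admissible A B t0 T y0 y v" and "t0 \<le> T"
  shows "lq_cost Q R H t0 T (\<lambda>t. x t + s *\<^sub>R y t) (\<lambda>t. u t + s *\<^sub>R v t) =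
    lq_cost Q R H t0 T x u + 2 * s * lq_polar Q R H t0 T x u y v + s\<^sup>2 * lq_cost Q R H t0 T y v"
proof -
  let ?p = "lq_polar Q R H t0 T" and ?x = "\<lambda>t. x t + s *\<^sub>R y t" and ?u = "\<lambda>t. u t + s *\<^sub>R v t"
  have "?p ?x ?u ?x ?u = ?p ?x ?u x u + s * ?p ?x ?u y v"
    using lq_polar_combine[OF lq_admissible_combine[OF x y] x y \<open>t0 \<le> T\<close>] .
  also have "?p ?x ?u x u = ?p x u x u + s * ?p x u y v"
    unfolding lq_polar_commute[OF psd, of _ _ ?x] by (rule lq_polar_combine[OF x x y \<open>t0 \<le> T\<close>])
  also have "?p ?x ?u y v = ?p x u y v + s * ?p y v y v"
    unfolding lq_polar_commute[OF psd, of _ _ ?x] lq_polar_combine[OF y x y \<open>t0 \<le> T\<close>]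
    by (simp add: lq_polar_commute[OF psd, of _ _ y v x u])
  finally show ?thesis by (simp add: lq_cost_eq_polar power2_eq_square algebra_simps)
qed

lemma lq_cost_nonneg:
  assumes "psd Q" "psd R" "psd H" and "lq_admissible A B t0 T x0 x u" and "t0 \<le> T"
  shows "0 \<le> lq_cost Q R H t0 T x u"
  unfolding lq_cost_def
  by (intro add_nonneg_nonneg Henstock_Kurzweil_Integration.integral_nonneg psd_nonneg assms(1-3)
      lq_polar_integrable[OF assms(4,4,5)])

text \<open>
  The first variation at an optimal pair vanishes along every direction that keeps the initial state, that
  is, along admissible pairs with initial state \<open>0\<close>.
\<close>

lemma lq_polar_optimal_eq_0:
  assumes psd: "psd Q" "psd R" "psd H" and opt: "lq_optimal A B Q R H t0 T x0 x u"
    and y: "lq_admissible A B t0 T 0 y v" and "t0 \<le> T"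
  shows "lq_polar Q R H t0 T x u y v = 0"
proof -
  have x: "lq_admissible A B t0 T x0 x u" using opt by (simp add: lq_optimal_def)
  define c where "c = lq_polar Q R H t0 T x u y v"
  define d where "d = lq_cost Q R H t0 T y v"
  have ge: "0 \<le> 2 * s * c + s\<^sup>2 * d" for s
  proof -
    have "lq_admissible A B t0 T x0 (\<lambda>t. x t + s *\<^sub>R y t) (\<lambda>t. u t + s *\<^sub>R v t)"
      using lq_admissible_combine[OF x y] by simp
    then have "lq_cost Q R H t0 T x u \<le> lq_cost Q R H t0 T (\<lambda>t. x t + s *\<^sub>R y t) (\<lambda>t. u t + s *\<^sub>R v t)"
      using opt by (simp add: lq_optimal_def)
    then show ?thesis
      unfolding lq_cost_combine[OF psd x y \<open>t0 \<le> T\<close>] by (simp add: c_def d_def)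
  qed
  show ?thesis using quadratic_nonneg_imp_linear_eq_0[OF ge] by (simp add: c_def)
qed

section \<open>Costates and first-order optimality\<close>

definition costate ::
  "real^'n^'n \<Rightarrow> real^'n^'n \<Rightarrow> real^'n^'n \<Rightarrow> real \<Rightarrow> real \<Rightarrow> (real \<Rightarrow> real^'n) \<Rightarrow>
   (real \<Rightarrow> real^'n) \<Rightarrow> bool" where
  "costate A Q H t0 T x p \<longleftrightarrow>
     (\<forall>t\<in>{t0..T}. (p has_vector_derivative - (transpose A *v p t) - Q *v x t) (at t within {t0..T})) \<and>
     p T = H *v x T"

text \<open>
  Integrating \<open>(p \<bullet> y)'\<close> from \<open>t0\<close> to \<open>T\<close>: the terms with \<open>A\<close> cancel, and the costate equation and
  its terminal value turn the state part of the polar form into a term in the control \<open>v\<close> and the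
  contribution \<open>p t0 \<bullet> y0\<close> of the initial state.
\<close>

lemma costate_pairing:
  assumes psd: "psd Q" "psd H" and x: "continuous_on {t0..T} x" and p: "costate A Q H t0 T x p"
    and y: "lq_admissible A B t0 T y0 y v" and "t0 \<le> T"
  shows "((\<lambda>t. x t \<bullet> (Q *v y t) - (transpose B *v p t) \<bullet> v t) has_integral
     p t0 \<bullet> y0 - x T \<bullet> (H *v y T)) {t0..T}"
proof -
  have p': "(p has_vector_derivative - (transpose A *v p t) - Q *v x t) (at t within {t0..T})"
    if "t \<in> {t0..T}" for t using p that by (simp add: costate_def)
  have contp: "continuous_on {t0..T} p" by (rule continuous_on_vector_derivative[OF p'])
  have sol: "solves_linear_ode (\<lambda>_. A) B t0 T y0 v y" and v: "square_integrable t0 T v"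
    using y by (auto simp: lq_admissible_def)
  have y0: "y t0 = y0" using solves_linear_ode_initial[OF sol \<open>t0 \<le> T\<close>] .
  have "((\<lambda>t. (- (transpose A *v p t) - Q *v x t) \<bullet> y t + p t \<bullet> (A *v y t + B *v v t)) has_integral
      (p T \<bullet> y T - p t0 \<bullet> y t0)) {t0..T}"
  proof (rule has_integral_product_rule[OF bounded_bilinear_inner \<open>t0 \<le> T\<close> p'])
    show "continuous_on {t0..T} (\<lambda>t. - (transpose A *v p t) - Q *v x t)"
      by (intro continuous_intros bounded_linear.continuous_on[OF matrix_vector_mul_bounded_linear] x contp)
    show "((\<lambda>t. A *v y t + B *v v t) has_integral (y t - y t0)) {t0..t}" if "t \<in> {t0..T}" for t
      using sol that by (simp add: solves_linear_ode_def y0)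
    show "(\<lambda>t. A *v y t + B *v v t) absolutely_integrable_on {t0..T}"
      by (intro square_integrable_absolutely_integrable square_integrable_add
          square_integrable_matrix_vector lq_admissible_square_integrable[OF y \<open>t0 \<le> T\<close>])
  qed
  from has_integral_neg[OF this]
  have "((\<lambda>t. - ((- (transpose A *v p t) - Q *v x t) \<bullet> y t + p t \<bullet> (A *v y t + B *v v t))) has_integral
      (p t0 \<bullet> y0 - p T \<bullet> y T)) {t0..T}" by (simp add: y0)
  moreover have "- ((- (transpose A *v p t) - Q *v x t) \<bullet> y t + p t \<bullet> (A *v y t + B *v v t)) =
      x t \<bullet> (Q *v y t) - (transpose B *v p t) \<bullet> v t" for t
    using psd_sym[OF psd(1), of "x t" "y t"]
    by (simp add: inner_diff_left inner_add_right inner_matrix_vector_left inner_commute[of "y t"])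
  moreover have "p T \<bullet> y T = x T \<bullet> (H *v y T)"
    using p psd_sym[OF psd(2), of "x T" "y T"] by (simp add: costate_def inner_commute)
  ultimately show ?thesis by simp
qed

text \<open>
  Pontryagin's condition is sufficient here: by stationarity the pairing lemma evaluates the polar form
  of \<open>(x, u)\<close> with any admissible pair as \<open>p t0\<close> times the initial state of that pair.  This gives the cost of
  \<open>(x, u)\<close>, and it vanishes on the difference to a competitor, whose own cost is nonnegative.
\<close>

theorem lq_optimal_of_costate:
  assumes psd: "psd Q" "psd R" "psd H" and "t0 \<le> T" and x: "lq_admissible A B t0 T x0 x u"
    and p: "costate A Q H t0 T x p"
    and stat: "\<And>t. t \<in> {t0..T} \<Longrightarrow> R *v u t = - (transpose B *v p t)"
  shows "lq_optimal A B Q R H t0 T x0 x u" and "lq_cost Q R H t0 T x u = p t0 \<bullet> x0"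
proof -
  have contx: "continuous_on {t0..T} x"
    using x \<open>t0 \<le> T\<close> by (auto simp: lq_admissible_def intro: solves_linear_ode_continuous)
  have polar: "lq_polar Q R H t0 T x u y v = p t0 \<bullet> y0" if y: "lq_admissible A B t0 T y0 y v" for y0 y v
  proof -
    have "integral {t0..T} (\<lambda>t. x t \<bullet> (Q *v y t) + u t \<bullet> (R *v v t)) =
      integral {t0..T} (\<lambda>t. x t \<bullet> (Q *v y t) - (transpose B *v p t) \<bullet> v t)"
    proof (rule Henstock_Kurzweil_Integration.integral_cong)
      fix t assume "t \<in> {t0..T}"
      have "u t \<bullet> (R *v v t) = v t \<bullet> - (transpose B *v p t)"
        using psd_sym[OF psd(2), of "u t" "v t"] stat[OF \<open>t \<in> {t0..T}\<close>] by simp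
      then show "x t \<bullet> (Q *v y t) + u t \<bullet> (R *v v t) = x t \<bullet> (Q *v y t) - (transpose B *v p t) \<bullet> v t"
        by (simp add: inner_commute)
    qed
    then show ?thesis
      using integral_unique[OF costate_pairing[OF psd(1,3) contx p y \<open>t0 \<le> T\<close>]]
      by (simp add: lq_polar_def)
  qed
  show "lq_cost Q R H t0 T x u = p t0 \<bullet> x0"
    unfolding lq_cost_eq_polar by (rule polar[OF x])
  show "lq_optimal A B Q R H t0 T x0 x u"
    unfolding lq_optimal_def
  proof (intro conjI x allI impI)
    fix y v assume y: "lq_admissible A B t0 T x0 y v"
    let ?y = "\<lambda>t. y t + (-1) *\<^sub>R x t" and ?v = "\<lambda>t. v t + (-1) *\<^sub>R u t"
    have d: "lq_admissible A B t0 T 0 ?y ?v"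
      using lq_admissible_combine[OF y x, of "-1"] by simp
    have "lq_cost Q R H t0 T y v = lq_cost Q R H t0 T x u + lq_cost Q R H t0 T ?y ?v"
      using lq_cost_combine[OF psd x d \<open>t0 \<le> T\<close>, of 1] polar[OF d] by simp
    then show "lq_cost Q R H t0 T x u \<le> lq_cost Q R H t0 T y v"
      using lq_cost_nonneg[OF psd d \<open>t0 \<le> T\<close>] by simp
  qed
qed

text \<open>
  Necessary conditions, obtained from two directions of variation.  The control \<open>G (B G)' p\<close> lies in
  the kernel of \<open>R\<close>, so only the costate enters the first variation, a multiple of the integral of
  \<open>norm ((B G)' p)\<close> squared.  The control \<open>u\<close> itself, with the state \<open>x\<close> minus the uncontrolled response,
  gives the formula for the cost.  Both directions need only solutions of differential equations
  with continuous data.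
\<close>

theorem lq_optimal_costate:
  fixes A :: "real^'n^'n" and B :: "real^'m^'n" and G :: "real^'k^'m"
  assumes psd: "psd Q" "psd R" "psd H" and "t0 < T" and opt: "lq_optimal A B Q R H t0 T x0 x u"
    and RG: "R ** G = 0"
  obtains p where "costate A Q H t0 T x p"
    and "\<And>t. t \<in> {t0..T} \<Longrightarrow> transpose (B ** G) *v p t = 0"
    and "lq_cost Q R H t0 T x u = p t0 \<bullet> x0"
proof -
  have "t0 \<le> T" using \<open>t0 < T\<close> by simp
  have x: "lq_admissible A B t0 T x0 x u" using opt by (simp add: lq_optimal_def)
  have contx: "continuous_on {t0..T} x"
    using x \<open>t0 \<le> T\<close> by (auto simp: lq_admissible_def intro: solves_linear_ode_continuous)
  have contM: "continuous_on {t0..T} (\<lambda>t. M *v f t)" if "continuous_on {t0..T} f"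
    for M :: "real^'a^'b" and f
    by (rule bounded_linear.continuous_on[OF matrix_vector_mul_bounded_linear that])
  obtain p where "p T = H *v x T" and
    p': "\<And>t. t \<in> {t0..T} \<Longrightarrow> (p has_vector_derivative - (transpose A *v p t) + - (Q *v x t)) (at t within {t0..T})"
    by (rule affine_ode_exists_backward[of "\<lambda>p. - (transpose A *v p)" t0 T "\<lambda>t. - (Q *v x t)" "H *v x T"])
       (use \<open>t0 \<le> T\<close> in \<open>auto intro!: bounded_linear_minus continuous_intros contM contx\<close>)
  then have p: "costate A Q H t0 T x p" by (simp add: costate_def)
  have contp: "continuous_on {t0..T} p" by (rule continuous_on_vector_derivative[OF p'])
  define q where "q t = transpose (B ** G) *v p t" for t
  have contq: "continuous_on {t0..T} q" unfolding q_def by (rule contM[OF contp])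
  obtain y where y0: "y t0 = 0"
    and y': "\<And>t. t \<in> {t0..T} \<Longrightarrow> (y has_vector_derivative A *v y t + B *v (G *v q t)) (at t within {t0..T})"
    by (rule affine_ode_exists_forward[of "(*v) A" t0 T "\<lambda>t. B *v (G *v q t)" 0])
       (use \<open>t0 \<le> T\<close> in \<open>auto intro!: contM contq\<close>)
  have y: "lq_admissible A B t0 T 0 y (\<lambda>t. G *v q t)"
    unfolding lq_admissible_def
    by (intro conjI square_integrable_continuous contM contq solves_linear_odeI_derivative y0 y')
  have RG': "R *v (G *v w) = 0" for w by (simp add: matrix_vector_mul_assoc RG)
  have q2: "(transpose B *v p t) \<bullet> (G *v q t) = q t \<bullet> q t" for t
    by (simp only: q_def inner_transpose_matrix_vector matrix_vector_mul_assoc matrix_mul_assoc)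
  have *: "integral {t0..T} (\<lambda>t. x t \<bullet> (Q *v y t)) + x T \<bullet> (H *v y T) = 0"
    using lq_polar_optimal_eq_0[OF psd opt y \<open>t0 \<le> T\<close>] by (simp add: lq_polar_def RG')
  have "((\<lambda>t. x t \<bullet> (Q *v y t)) has_integral integral {t0..T} (\<lambda>t. x t \<bullet> (Q *v y t))) {t0..T}"
    by (intro integrable_integral square_integrable_inner square_integrable_matrix_vector
        lq_admissible_square_integrable[OF x \<open>t0 \<le> T\<close>] lq_admissible_square_integrable[OF y \<open>t0 \<le> T\<close>])
  from has_integral_diff[OF this costate_pairing[OF psd(1,3) contx p y \<open>t0 \<le> T\<close>]]
  have "((\<lambda>t. q t \<bullet> q t) has_integral 0) {t0..T}"
    using * by (simp add: q2)
  then have "integral {t0..T} (\<lambda>t. q t \<bullet> q t) = 0" by (rule integral_unique)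
  moreover have "continuous_on {t0..T} (\<lambda>t. q t \<bullet> q t)" by (intro continuous_on_inner contq)
  ultimately have q0: "q t = 0" if "t \<in> {t0..T}" for t
    using integral_eq_0_iff[of t0 T "\<lambda>t. q t \<bullet> q t"] \<open>t0 < T\<close> that by simp
  obtain z where z0: "z t0 = x0"
    and z': "\<And>t. t \<in> {t0..T} \<Longrightarrow> (z has_vector_derivative A *v z t + 0) (at t within {t0..T})"
    by (rule affine_ode_exists_forward[of "(*v) A" t0 T "\<lambda>t. 0" x0])
       (use \<open>t0 \<le> T\<close> in auto)
  have z: "lq_admissible A B t0 T x0 z (\<lambda>_. 0)"
    unfolding lq_admissible_def
    by (intro conjI square_integrable_continuous solves_linear_odeI_derivative)
       (use z0 z' in auto)
  have "lq_polar Q R H t0 T x u (\<lambda>t. x t + (-1) *\<^sub>R z t) (\<lambda>t. u t + (-1) *\<^sub>R 0) = 0"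
    using lq_admissible_combine[OF x z, of "-1"]
    by (intro lq_polar_optimal_eq_0[OF psd opt _ \<open>t0 \<le> T\<close>]) simp
  then have "lq_cost Q R H t0 T x u = lq_polar Q R H t0 T x u z (\<lambda>_. 0)"
    unfolding lq_polar_combine[OF x x z \<open>t0 \<le> T\<close>] by (simp add: lq_cost_eq_polar)
  also have "\<dots> = p t0 \<bullet> x0"
    using integral_unique[OF costate_pairing[OF psd(1,3) contx p z \<open>t0 \<le> T\<close>]]
    by (simp add: lq_polar_def)
  finally show ?thesis using that p q0 by (simp add: q_def)
qed

section \<open>The Riccati equation\<close>

text \<open>
  \<open>Z s - Z0 = Z s ** (X0 - X s) ** Z0\<close>; near the limit this first bounds \<open>Z s\<close> by twice the norm of \<open>Z0\<close>
  and then makes the difference small.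
\<close>

lemma tendsto_matrix_inverse:
  fixes X Z :: "'a \<Rightarrow> real^'n^'n"
  assumes X: "(X \<longlongrightarrow> X0) F" and inv: "\<forall>\<^sub>F s in F. Z s ** X s = mat 1" and Z0: "X0 ** Z0 = mat 1"
  shows "(Z \<longlongrightarrow> Z0) F"
proof -
  obtain K where "K > 0" and K: "\<And>(U :: real^'n^'n) (V :: real^'n^'n). norm (U ** V) \<le> norm U * norm V * K"
    using bounded_bilinear.pos_bounded[OF bounded_bilinear_matrix_matrix] by blast
  have diff: "Z s - Z0 = Z s ** (X0 - X s) ** Z0" if "Z s ** X s = mat 1" for s
  proof -
    have "Z s ** (X0 - X s) ** Z0 = Z s ** (X0 ** Z0) - Z s ** X s ** Z0"
      by (simp add: matrix_mult_bilinear matrix_mul_assoc)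
    then show ?thesis by (simp add: Z0 that)
  qed
  have bound: "norm (Z s - Z0) \<le> norm (Z s) * (norm (X s - X0) * norm Z0 * K\<^sup>2)"
    if "Z s ** X s = mat 1" for s
  proof -
    have "norm (Z s - Z0) \<le> norm (Z s ** (X0 - X s)) * norm Z0 * K" 
      unfolding diff[OF that] using K[of "Z s ** (X0 - X s)" Z0] .
    also have "\<dots> \<le> (norm (Z s) * norm (X0 - X s) * K) * norm Z0 * K"
      using \<open>K > 0\<close> by (intro mult_right_mono K) auto
    finally show ?thesis by (simp add: power2_eq_square mult_ac norm_minus_commute)
  qed
  have dist0: "((\<lambda>s. norm (X s - X0) * norm Z0 * K\<^sup>2) \<longlongrightarrow> 0) F"
    using X by (intro tendsto_mult_left_zero tendsto_norm_zero LIM_zero)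
  have "\<forall>\<^sub>F s in F. norm (X s - X0) * norm Z0 * K\<^sup>2 < 1/2"
    by (rule order_tendstoD(2)[OF dist0]) simp
  then have "\<forall>\<^sub>F s in F. norm (Z s - Z0) \<le> 2 * norm Z0 * (norm (X s - X0) * norm Z0 * K\<^sup>2)"
    using inv
  proof eventually_elim
    case (elim s)
    have "norm (Z s) \<le> norm Z0 + norm (Z s - Z0)" using norm_triangle_ineq[of Z0 "Z s - Z0"] by simp
    also have "norm (Z s - Z0) \<le> norm (Z s) * (1/2)"
      using bound[OF elim(2)] mult_left_mono[OF less_imp_le[OF elim(1)] norm_ge_zero[of "Z s"]] by linarith
    finally have "norm (Z s) \<le> 2 * norm Z0" by simp
    then have "norm (Z s) * (norm (X s - X0) * norm Z0 * K\<^sup>2) \<le> 2 * norm Z0 * (norm (X s - X0) * norm Z0 * K\<^sup>2)"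
      by (intro mult_right_mono) auto
    then show ?case using bound[OF elim(2)] by linarith
  qed
  then have "((\<lambda>s. Z s - Z0) \<longlongrightarrow> 0) F"
    using tendsto_mult_right_zero[OF dist0] by (rule Lim_null_comparison)
  then show ?thesis by (rule LIM_zero_cancel)
qed

lemma has_vector_derivative_matrix_inverse:
  fixes X Z :: "real \<Rightarrow> real^'n^'n"
  assumes X: "(X has_vector_derivative X') (at t within S)" and "t \<in> S"
    and inv: "\<And>s. s \<in> S \<Longrightarrow> Z s ** X s = mat 1" and inv': "X t ** Z t = mat 1"
  shows "(Z has_vector_derivative - (Z t ** X' ** Z t)) (at t within S)"
proof -
  let ?F = "at t within S"
  have Slim: "\<forall>\<^sub>F s in ?F. s \<in> S" by (simp add: eventually_at_filter)
  have "(X \<longlongrightarrow> X t) ?F"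
    using has_vector_derivative_continuous[OF X] by (simp add: continuous_within)
  then have Z: "(Z \<longlongrightarrow> Z t) ?F"
    by (rule tendsto_matrix_inverse[OF _ _ inv']) (use Slim inv in \<open>auto elim: eventually_mono\<close>)
  define r where "r s = ((X s - X t) - (s - t) *\<^sub>R X') /\<^sub>R norm (s - t)" for s
  have r: "(r \<longlongrightarrow> 0) ?F"
    using X unfolding has_vector_derivative_def has_derivative_at_within r_def[abs_def] by blast
  have 1: "((\<lambda>s. - (Z s ** r s ** Z t)) \<longlongrightarrow> 0) ?F"
  proof -
    have "((\<lambda>s. - (Z s ** r s ** Z t)) \<longlongrightarrow> - (Z t ** 0 ** Z t)) ?F"
      by (intro tendsto_minus bounded_bilinear.tendsto[OF bounded_bilinear_matrix_matrix] Z r tendsto_const)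
    then show ?thesis by (simp add: matrix_mult_zero_left matrix_mult_zero_right)
  qed
  have "((\<lambda>s. (Z s - Z t) ** X' ** Z t) \<longlongrightarrow> (Z t - Z t) ** X' ** Z t) ?F"
    by (intro bounded_bilinear.tendsto[OF bounded_bilinear_matrix_matrix] tendsto_diff Z tendsto_const)
  then have "((\<lambda>s. (Z s - Z t) ** X' ** Z t) \<longlongrightarrow> 0) ?F"
    by (simp add: matrix_mult_zero_left)
  then have 2: "((\<lambda>s. ((s - t) / norm (s - t)) *\<^sub>R ((Z s - Z t) ** X' ** Z t)) \<longlongrightarrow> 0) ?F"
    by (rule Lim_null_comparison[rotated, OF tendsto_norm_zero])
       (auto intro!: always_eventually simp: mult_le_cancel_right1 divide_simps)
  \<comment> \<open>The remainder of the claimed linear approximation, divided by \<open>norm (s - t)\<close>, as a difference of two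
    terms that tend to \<open>0\<close>.\<close>
  have eq: "\<forall>\<^sub>F s in ?F. - (Z s ** r s ** Z t) - ((s - t) / norm (s - t)) *\<^sub>R ((Z s - Z t) ** X' ** Z t) =
      ((Z s - Z t) - (s - t) *\<^sub>R - (Z t ** X' ** Z t)) /\<^sub>R norm (s - t)"
    using Slim
  proof eventually_elim
    case (elim s)
    have "Z s ** (X s - X t) ** Z t = Z s ** X s ** Z t - Z s ** (X t ** Z t)"
      by (simp add: matrix_mult_bilinear matrix_mul_assoc)
    then have "Z s - Z t = - (Z s ** (X s - X t) ** Z t)"
      by (simp add: inv' inv[OF elim])
    moreover have "- (Z s ** ((W - c *\<^sub>R X') /\<^sub>R n) ** Z t) - (c / n) *\<^sub>R ((Z s - Z t) ** X' ** Z t) =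
        (- (Z s ** W ** Z t) - c *\<^sub>R - (Z t ** X' ** Z t)) /\<^sub>R n" for W c n
      by (simp add: matrix_mult_bilinear algebra_simps divide_inverse)
    ultimately show ?case by (simp add: r_def)
  qed
  have "((\<lambda>s. ((Z s - Z t) - (s - t) *\<^sub>R - (Z t ** X' ** Z t)) /\<^sub>R norm (s - t)) \<longlongrightarrow> 0) ?F"
    using Lim_transform_eventually[OF tendsto_diff[OF 1 2] eq] by simp
  then show ?thesis
    unfolding has_vector_derivative_def has_derivative_at_within
    by (intro conjI bounded_linear_scaleR_left)
qed

lemma linear_matrix_ode_eq_0:
  fixes D :: "real \<Rightarrow> real^'k^'n"
  assumes D: "\<And>t. t \<in> {a..b} \<Longrightarrow> (D has_vector_derivative F t ** D t + D t ** G t) (at t within {a..b})"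
    and F: "continuous_on {a..b} F" and G: "continuous_on {a..b} G"
    and c: "c \<in> {a..b}" "D c = 0" and t: "t \<in> {a..b}"
  shows "D t = 0"
proof -
  obtain K1 where "K1 > 0" and K1: "\<And>(U :: real^'n^'n) (V :: real^'k^'n). norm (U ** V) \<le> norm U * norm V * K1"
    using bounded_bilinear.pos_bounded[OF bounded_bilinear_matrix_matrix] by blast
  obtain K2 where "K2 > 0" and K2: "\<And>(U :: real^'k^'n) (V :: real^'k^'k). norm (U ** V) \<le> norm U * norm V * K2"
    using bounded_bilinear.pos_bounded[OF bounded_bilinear_matrix_matrix] by blast
  have "bounded (F ` {a..b})" "bounded (G ` {a..b})"
    by (auto intro!: compact_imp_bounded compact_continuous_image F G)
  then obtain C1 C2 where C1: "\<And>s. s \<in> {a..b} \<Longrightarrow> norm (F s) \<le> C1"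
    and C2: "\<And>s. s \<in> {a..b} \<Longrightarrow> norm (G s) \<le> C2"
    unfolding bounded_iff by blast
  show ?thesis
  proof (rule gronwall_zero[OF D _ c t])
    fix s assume s: "s \<in> {a..b}"
    have "norm (F s ** D s) \<le> C1 * norm (D s) * K1"
      using K1[of "F s" "D s"] mult_right_mono[OF mult_right_mono[OF C1[OF s] norm_ge_zero[of "D s"]], of K1]
        \<open>K1 > 0\<close> by linarith
    moreover have "norm (D s ** G s) \<le> norm (D s) * C2 * K2"
      using K2[of "D s" "G s"] mult_right_mono[OF mult_left_mono[OF C2[OF s] norm_ge_zero[of "D s"]], of K2]
        \<open>K2 > 0\<close> by linarith
    ultimately show "norm (F s ** D s + D s ** G s) \<le> (C1 * K1 + C2 * K2) * norm (D s)"
      using norm_triangle_ineq[of "F s ** D s" "D s ** G s"] by (simp add: algebra_simps)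
  qed
qed

text \<open>
  The transpose of a solution solves the same equation, and the difference of the two solves a linear one.
\<close>

lemma riccati_symmetric:
  fixes S :: "real \<Rightarrow> real^'n^'n"
  assumes S: "\<And>t. t \<in> {a..b} \<Longrightarrow> (S has_vector_derivative
      - (transpose A ** S t) - S t ** A - Q + S t ** M ** S t) (at t within {a..b})"
    and sym: "transpose Q = Q" "transpose M = M" "transpose (S b) = S b" and t: "t \<in> {a..b}"
  shows "transpose (S t) = S t"
proof -
  let ?D = "\<lambda>t. S t - transpose (S t)"
  have cont: "continuous_on {a..b} S" by (rule continuous_on_vector_derivative[OF S])
  have "?D t = 0"
  proof (rule linear_matrix_ode_eq_0[where c = b and t = t])
    show "(?D has_vector_derivative (transpose (S t) ** M - transpose A) ** ?D t + ?D t ** (M ** S t - A))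
        (at t within {a..b})" if "t \<in> {a..b}" for t
      using has_vector_derivative_diff[OF S[OF that] bounded_linear.has_vector_derivative[OF bounded_linear_transpose S[OF that]]]
      by (rule has_vector_derivative_eq_rhs)
         (simp add: transpose_add transpose_diff transpose_minus matrix_transpose_mul sym
           matrix_mult_bilinear matrix_mul_assoc)
    show "continuous_on {a..b} (\<lambda>t. transpose (S t) ** M - transpose A)"
      "continuous_on {a..b} (\<lambda>t. M ** S t - A)"
      by (intro continuous_on_diff continuous_on_matrix_mult continuous_on_const cont
          bounded_linear.continuous_on[OF bounded_linear_transpose])+
  qed (use t sym in auto)
  then show ?thesis by simp
qed

text \<open>
  A Riccati equation can blow up, but not with semidefinite data.  The solution is \<open>S = Y X\<^sup>-\<^sup>1\<close>, where
  \<open>(X, Y)\<close> solves the linear Hamiltonian system with terminal value \<open>(I, H)\<close>, so the point is that \<open>X t\<close>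
  is invertible.  If \<open>X t v = 0\<close>, put \<open>x = X v\<close> and \<open>y = Y v\<close>: since \<open>(x \<bullet> y)' = - y' M y - x' Q x\<close>, integration
  over \<open>[t, b]\<close> shows that a nonnegative integral equals \<open>- v' H v\<close>.  Hence \<open>M y = 0\<close> on \<open>[t, b]\<close>, so \<open>x\<close> solves
  \<open>x' = A x\<close> with \<open>x t = 0\<close>, and \<open>v = x b = 0\<close>.  The function \<open>X\<close> is returned as well, being a fundamental
  matrix of the closed loop \<open>x' = (A - M S) x\<close>.
\<close>

theorem riccati_exists:
  fixes A Q M H :: "real^'n^'n"
  assumes Q: "psd Q" and M: "psd M" and H: "psd H" and "a \<le> b"
  obtains S X :: "real \<Rightarrow> real^'n^'n" where "S b = H"
    and "\<And>t. t \<in> {a..b} \<Longrightarrow> (S has_vector_derivative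
        - (transpose A ** S t) - S t ** A - Q + S t ** M ** S t) (at t within {a..b})"
    and "\<And>t. t \<in> {a..b} \<Longrightarrow> (X has_vector_derivative (A - M ** S t) ** X t) (at t within {a..b})"
    and "\<And>t. t \<in> {a..b} \<Longrightarrow> invertible (X t)"
proof -
  let ?L = "\<lambda>(X, Y). (A ** X - M ** Y, - (Q ** X) - transpose A ** Y)"
  have "bounded_linear ?L"
    unfolding linear_conv_bounded_linear[symmetric]
    by (auto intro!: linearI simp: matrix_mult_bilinear algebra_simps)
  then obtain z where zb: "z b = (mat 1, H)"
    and z: "\<And>t. t \<in> {a..b} \<Longrightarrow> (z has_vector_derivative ?L (z t) + 0) (at t within {a..b})"
    by (rule affine_ode_exists_backward[of ?L a b "\<lambda>_. 0" "(mat 1, H)"]) (use \<open>a \<le> b\<close> in auto)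
  define X where "X t = fst (z t)" for t
  define Y where "Y t = snd (z t)" for t
  have X: "(X has_vector_derivative A ** X t - M ** Y t) (at t within {a..b})"
    and Y: "(Y has_vector_derivative - (Q ** X t) - transpose A ** Y t) (at t within {a..b})"
    if "t \<in> {a..b}" for t
    using bounded_linear.has_vector_derivative[OF bounded_linear_fst z[OF that]]
      bounded_linear.has_vector_derivative[OF bounded_linear_snd z[OF that]]
    by (simp_all add: X_def[abs_def] Y_def[abs_def] case_prod_unfold)
  have inj: "v = 0" if t: "t \<in> {a..b}" and v: "X t *v v = 0" for t v
  proof (cases "t = b")
    case True
    then show ?thesis using v zb by (simp add: X_def)
  next
    case False
    then have "t < b" and sub: "{t..b} \<subseteq> {a..b}" using t by auto
    define x where "x s = X s *v v" for s
    define y where "y s = Y s *v v" for s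
    have v_bl: "bounded_linear (\<lambda>U :: real^'n^'n. U *v v)"
      by (rule bounded_bilinear.bounded_linear_left[OF bounded_bilinear_matrix_vector])
    have x: "(x has_vector_derivative A *v x s - M *v y s) (at s within {t..b})"
      and y: "(y has_vector_derivative - (Q *v x s) - transpose A *v y s) (at s within {t..b})"
      if "s \<in> {t..b}" for s
    proof -
      have s: "s \<in> {a..b}" using that sub by auto
      show "(x has_vector_derivative A *v x s - M *v y s) (at s within {t..b})"
        using has_vector_derivative_within_subset[OF bounded_linear.has_vector_derivative[OF v_bl X[OF s]] sub]
        by (simp add: x_def[abs_def] y_def algebra_simps matrix_vector_mul_assoc)
      show "(y has_vector_derivative - (Q *v x s) - transpose A *v y s) (at s within {t..b})"
        using has_vector_derivative_within_subset[OF bounded_linear.has_vector_derivative[OF v_bl Y[OF s]] sub]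
        by (simp add: x_def y_def[abs_def] algebra_simps matrix_vector_mul_assoc matrix_vector_minus_left)
    qed
    let ?\<psi> = "\<lambda>s. y s \<bullet> (M *v y s) + x s \<bullet> (Q *v x s)"
    have xy: "((\<lambda>s. x s \<bullet> y s) has_vector_derivative - ?\<psi> s) (at s within {t..b})" if "s \<in> {t..b}" for s
      using bounded_bilinear.has_vector_derivative[OF bounded_bilinear_inner x[OF that] y[OF that]]
      by (rule has_vector_derivative_eq_rhs)
         (simp add: inner_diff_left inner_diff_right inner_matrix_vector_left[of A] inner_commute[of "M *v _"])
    have "((\<lambda>s. - ?\<psi> s) has_integral (x b \<bullet> y b - x t \<bullet> y t)) {t..b}"
      using \<open>t < b\<close> by (intro fundamental_theorem_of_calculus xy) auto
    from has_integral_neg[OF this]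
    have "(?\<psi> has_integral - (x b \<bullet> y b - x t \<bullet> y t)) {t..b}" by (simp only: minus_minus)
    moreover have "x b = v" "y b = H *v v" "x t = 0"
      using zb v by (simp_all add: x_def y_def X_def Y_def)
    ultimately have "integral {t..b} ?\<psi> = - (v \<bullet> (H *v v))"
      by (simp add: integral_unique)
    then have "integral {t..b} ?\<psi> \<le> 0" using psd_nonneg[OF H, of v] by simp
    have contx: "continuous_on {t..b} x" by (rule continuous_on_vector_derivative[OF x])
    have conty: "continuous_on {t..b} y" by (rule continuous_on_vector_derivative[OF y])
    have cont: "continuous_on {t..b} ?\<psi>"
      by (intro continuous_on_add continuous_on_inner continuous_on_matrix_vector continuous_on_const
          contx conty)
    have nonneg: "0 \<le> ?\<psi> s" for s by (intro add_nonneg_nonneg psd_nonneg M Q)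
    have "integral {t..b} ?\<psi> \<ge> 0"
      by (intro Henstock_Kurzweil_Integration.integral_nonneg integrable_continuous_real cont nonneg)
    with \<open>integral {t..b} ?\<psi> \<le> 0\<close> have "integral {t..b} ?\<psi> = 0" by (rule order_antisym)
    then have \<psi>0: "?\<psi> s = 0" if "s \<in> {t..b}" for s
      using integral_eq_0_iff[OF cont \<open>t < b\<close> nonneg] that by blast
    have My: "M *v y s = 0" if "s \<in> {t..b}" for s
      using \<psi>0[OF that] psd_nonneg[OF M, of "y s"] psd_nonneg[OF Q, of "x s"]
      by (intro psd_eq_0[OF M]) linarith
    obtain K where K: "\<And>w. norm (A *v w) \<le> norm w * K"
      using bounded_linear.bounded[OF matrix_vector_mul_bounded_linear] by blast
    have "x b = 0"
    proof (rule gronwall_zero[where a = t and b = b and c = t and f = x and K = K])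
      show "(x has_vector_derivative A *v x s) (at s within {t..b})" if "s \<in> {t..b}" for s
        using x[OF that] My[OF that] by simp
      show "norm (A *v x s) \<le> K * norm (x s)" for s using K[of "x s"] by (simp add: mult.commute)
    qed (use \<open>t < b\<close> v in \<open>auto simp: x_def\<close>)
    then show ?thesis using zb by (simp add: x_def X_def)
  qed
  have invX: "invertible (X t)" if "t \<in> {a..b}" for t
    using inj[OF that] by (auto simp: invertible_left_inverse matrix_left_invertible_ker)
  then have "\<forall>t. \<exists>Z. t \<in> {a..b} \<longrightarrow> X t ** Z = mat 1 \<and> Z ** X t = mat 1"
    by (auto simp: invertible_def)
  then obtain Z where XZ: "\<And>t. t \<in> {a..b} \<Longrightarrow> X t ** Z t = mat 1"
    and ZX: "\<And>t. t \<in> {a..b} \<Longrightarrow> Z t ** X t = mat 1"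
    by metis
  define S where "S t = Y t ** Z t" for t
  have SX: "S t ** X t = Y t" if "t \<in> {a..b}" for t
    using ZX[OF that] by (simp add: S_def matrix_mul_assoc[symmetric])
  show ?thesis
  proof (rule that[of S X])
    have "b \<in> {a..b}" using \<open>a \<le> b\<close> by simp
    then show "S b = H" using SX[of b] zb by (simp add: X_def Y_def)
    fix t assume t: "t \<in> {a..b}"
    show "invertible (X t)" by (rule invX[OF t])
    show "(X has_vector_derivative (A - M ** S t) ** X t) (at t within {a..b})"
      using X[OF t] by (simp add: matrix_mult_bilinear matrix_mul_assoc[symmetric] SX[OF t])
    have "(Z has_vector_derivative - (Z t ** (A ** X t - M ** Y t) ** Z t)) (at t within {a..b})"
      by (rule has_vector_derivative_matrix_inverse[OF X[OF t] t ZX XZ[OF t]])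
    from bounded_bilinear.has_vector_derivative[OF bounded_bilinear_matrix_matrix Y[OF t] this]
    show "(S has_vector_derivative - (transpose A ** S t) - S t ** A - Q + S t ** M ** S t) (at t within {a..b})"
      unfolding S_def[abs_def]
      by (rule has_vector_derivative_eq_rhs)
         (simp add: matrix_mult_bilinear matrix_mul_assoc[symmetric] XZ[OF t])
  qed
qed

section \<open>Controllable states\<close>

text \<open>
  As a hull the subspace comes with the rule needed below: to see that it is contained in a subspace, it
  suffices to check that the latter is \<open>A\<close>-invariant and contains the range of \<open>B\<close>.
\<close>

definition controllable_subspace :: "real^'n^'n \<Rightarrow> real^'m^'n \<Rightarrow> (real^'n) set" where
  "controllable_subspace A B = (\<lambda>V. subspace V \<and> (\<forall>v\<in>V. A *v v \<in> V)) hull range ((*v) B)"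

lemma subspace_controllable_subspace: "subspace (controllable_subspace A B)"
  and controllable_subspace_invariant:
    "v \<in> controllable_subspace A B \<Longrightarrow> A *v v \<in> controllable_subspace A B"
proof -
  have "subspace (controllable_subspace A B) \<and>
      (\<forall>v\<in>controllable_subspace A B. A *v v \<in> controllable_subspace A B)"
    unfolding controllable_subspace_def by (rule hull_in) (auto intro: subspace_Inter)
  then show "subspace (controllable_subspace A B)"
    "v \<in> controllable_subspace A B \<Longrightarrow> A *v v \<in> controllable_subspace A B" by auto
qed

lemma range_subset_controllable_subspace: "B *v w \<in> controllable_subspace A B"
  unfolding controllable_subspace_def by (intro hull_inc) simp

lemma controllable_subspace_minimal:
  assumes "subspace V" and "\<And>w. B *v w \<in> V" and "\<And>v. v \<in> V \<Longrightarrow> A *v v \<in> V"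
  shows "controllable_subspace A B \<subseteq> V"
  unfolding controllable_subspace_def using assms by (intro hull_minimal) auto

lemma inner_eq_0_derivative:
  assumes "a < b" and p: "\<And>t. t \<in> {a..b} \<Longrightarrow> (p has_vector_derivative p' t) (at t within {a..b})"
    and 0: "\<And>t. t \<in> {a..b} \<Longrightarrow> p t \<bullet> c = 0" and t: "t \<in> {a..b}"
  shows "p' t \<bullet> c = 0"
proof -
  have "((\<lambda>t. p t \<bullet> c) has_vector_derivative p' t \<bullet> c) (at t within {a..b})"
    by (rule bounded_linear.has_vector_derivative[OF bounded_linear_inner_left p[OF t]])
  moreover have "((\<lambda>t. p t \<bullet> c) has_vector_derivative 0) (at t within {a..b})"
    by (rule has_vector_derivative_transform[OF t _ has_vector_derivative_const[of 0]]) (simp add: 0)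
  ultimately show ?thesis
    using vector_derivative_unique_within_closed_interval[of a b t] \<open>a < b\<close> t by fastforce
qed

text \<open>
  The end points reachable from \<open>0\<close> form a subspace.  Let \<open>q\<close> be orthogonal to it and let \<open>p\<close> solve the
  adjoint equation with \<open>p b = q\<close>.  Steering with \<open>\<phi> = B' p\<close> gives \<open>q \<bullet> z b\<close> as the integral of
  \<open>norm (B' p)\<close> squared, so \<open>B' p = 0\<close> throughout; the vectors orthogonal to \<open>p t\<close> for all \<open>t\<close>
  then form an \<open>A\<close>-invariant subspace containing the range of \<open>B\<close>, and \<open>q\<close> is orthogonal to the controllable
  subspace.
\<close>

theorem controllable_subspace_reachable:
  fixes A :: "real^'n^'n" and B :: "real^'m^'n"
  assumes "a < b" and n: "n \<in> controllable_subspace A B"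
  obtains \<phi> z where "continuous_on {a..b} \<phi>" and "z a = 0" and "z b = n"
    and "\<And>t. t \<in> {a..b} \<Longrightarrow> (z has_vector_derivative A *v z t + B *v \<phi> t) (at t within {a..b})"
proof -
  define reach where "reach \<phi> z \<longleftrightarrow> continuous_on {a..b} \<phi> \<and> z a = 0 \<and>
    (\<forall>t\<in>{a..b}. (z has_vector_derivative A *v z t + B *v \<phi> t) (at t within {a..b}))" for \<phi> z
  define V where "V = {z b | \<phi> z. reach \<phi> z}"
  have VI: "z b \<in> V" if "reach \<phi> z" for \<phi> z using that by (auto simp: V_def)
  have reachD: "(z has_vector_derivative A *v z t + B *v \<phi> t) (at t within {a..b})"
    if "reach \<phi> z" "t \<in> {a..b}" for \<phi> z t using that by (simp add: reach_def)
  have "subspace V"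
  proof (rule subspaceI)
    have "reach (\<lambda>_. 0) (\<lambda>_. 0)" by (simp add: reach_def)
    from VI[OF this] show "0 \<in> V" .
    show "v + w \<in> V" if v: "v \<in> V" and w: "w \<in> V" for v w
    proof -
      obtain \<phi> z where "reach \<phi> z" "v = z b" using v by (auto simp: V_def)
      moreover obtain \<phi>' z' where "reach \<phi>' z'" "w = z' b" using w by (auto simp: V_def)
      ultimately have *: "reach \<phi> z" "v = z b" "reach \<phi>' z'" "w = z' b" by auto
      have "((\<lambda>t. z t + z' t) has_vector_derivative
          A *v (z t + z' t) + B *v (\<phi> t + \<phi>' t)) (at t within {a..b})" if "t \<in> {a..b}" for t
        using has_vector_derivative_add[OF reachD[OF *(1) that] reachD[OF *(3) that]]
        by (rule has_vector_derivative_eq_rhs) (simp add: algebra_simps)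
      then have "reach (\<lambda>t. \<phi> t + \<phi>' t) (\<lambda>t. z t + z' t)"
        using * by (auto simp: reach_def intro: continuous_on_add)
      from VI[OF this] show ?thesis using * by simp
    qed
    show "c *\<^sub>R v \<in> V" if v: "v \<in> V" for c v
    proof -
      obtain \<phi> z where *: "reach \<phi> z" "v = z b" using v by (auto simp: V_def)
      have "((\<lambda>t. c *\<^sub>R z t) has_vector_derivative
          A *v (c *\<^sub>R z t) + B *v (c *\<^sub>R \<phi> t)) (at t within {a..b})" if "t \<in> {a..b}" for t
        using bounded_linear.has_vector_derivative[OF bounded_linear_scaleR_right reachD[OF *(1) that], of c]
        by (rule has_vector_derivative_eq_rhs) (simp add: algebra_simps)
      then have "reach (\<lambda>t. c *\<^sub>R \<phi> t) (\<lambda>t. c *\<^sub>R z t)"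
        using * by (auto simp: reach_def intro: continuous_on_scaleR continuous_on_const)
      from VI[OF this] show ?thesis using * by simp
    qed
  qed
  obtain r q where "r \<in> span V" and q: "\<And>w. w \<in> span V \<Longrightarrow> orthogonal q w" and n_eq: "n = r + q"
    by (rule orthogonal_subspace_decomp_exists[of V n]) blast
  then have r: "r \<in> V" using \<open>subspace V\<close> by (simp add: span_eq_iff[THEN iffD2])
  have qV: "q \<bullet> w = 0" if "w \<in> V" for w using q span_base[OF that] by (simp add: orthogonal_def)
  have "bounded_linear (\<lambda>p. - (transpose A *v p))" by (intro bounded_linear_minus) simp
  then obtain p where pb: "p b = q"
    and p: "\<And>t. t \<in> {a..b} \<Longrightarrow> (p has_vector_derivative - (transpose A *v p t) + 0) (at t within {a..b})"
    by (rule affine_ode_exists_backward[of _ a b "\<lambda>_. 0" q]) (use \<open>a < b\<close> in auto)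
  have contp: "continuous_on {a..b} p" by (rule continuous_on_vector_derivative[OF p])
  define \<phi> where "\<phi> t = transpose B *v p t" for t
  have cont\<phi>: "continuous_on {a..b} \<phi>"
    unfolding \<phi>_def by (intro continuous_on_matrix_vector continuous_on_const contp)
  obtain z where za: "z a = 0"
    and z: "\<And>t. t \<in> {a..b} \<Longrightarrow> (z has_vector_derivative A *v z t + B *v \<phi> t) (at t within {a..b})"
    by (rule affine_ode_exists_forward[of "(*v) A" a b "\<lambda>t. B *v \<phi> t" 0])
       (use \<open>a < b\<close> in \<open>auto intro!: continuous_on_matrix_vector cont\<phi> continuous_on_const\<close>)
  have "reach \<phi> z" using za z cont\<phi> by (simp add: reach_def)
  then have zV: "z b \<in> V" by (rule VI)
  have "((\<lambda>t. p t \<bullet> z t) has_vector_derivative \<phi> t \<bullet> \<phi> t) (at t within {a..b})" if "t \<in> {a..b}" for t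
    using bounded_bilinear.has_vector_derivative[OF bounded_bilinear_inner p[OF that] z[OF that]]
    by (rule has_vector_derivative_eq_rhs)
       (simp add: \<phi>_def inner_add_right inner_transpose_matrix_vector)
  then have "((\<lambda>t. \<phi> t \<bullet> \<phi> t) has_integral (p b \<bullet> z b - p a \<bullet> z a)) {a..b}"
    using \<open>a < b\<close> by (intro fundamental_theorem_of_calculus) auto
  then have "integral {a..b} (\<lambda>t. \<phi> t \<bullet> \<phi> t) = 0"
    by (simp add: integral_unique pb za qV[OF zV])
  moreover have "continuous_on {a..b} (\<lambda>t. \<phi> t \<bullet> \<phi> t)" by (intro continuous_on_inner cont\<phi>)
  ultimately have \<phi>0: "\<phi> t = 0" if "t \<in> {a..b}" for t
    using integral_eq_0_iff[of a b "\<lambda>t. \<phi> t \<bullet> \<phi> t"] \<open>a < b\<close> that by simp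
  \<comment> \<open>Invariance of \<open>W\<close> under \<open>A\<close> is the derivative of the identity that defines it.\<close>
  define W where "W = {c. \<forall>t\<in>{a..b}. p t \<bullet> c = 0}"
  have "controllable_subspace A B \<subseteq> W"
  proof (rule controllable_subspace_minimal)
    show "subspace W"
      by (rule subspaceI) (auto simp: W_def inner_add_right)
    show "B *v w \<in> W" for w
      using \<phi>0 by (simp add: W_def \<phi>_def inner_transpose_matrix_vector[symmetric])
    show "A *v c \<in> W" if "c \<in> W" for c
      unfolding W_def
    proof (intro CollectI ballI)
      fix t assume t: "t \<in> {a..b}"
      have "(- (transpose A *v p t) + 0) \<bullet> c = 0"
        by (rule inner_eq_0_derivative[OF \<open>a < b\<close> p _ t]) (use that in \<open>auto simp: W_def\<close>)
      then show "p t \<bullet> (A *v c) = 0" by (simp add: inner_transpose_matrix_vector)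
    qed
  qed
  then have "q \<bullet> n = 0" using n pb \<open>a < b\<close> by (auto simp: W_def)
  then have "q = 0" using n_eq qV[OF r] by (simp add: inner_add_right)
  then have "n \<in> V" using n_eq r by simp
  then show ?thesis using that unfolding V_def reach_def by blast
qed

section \<open>Block form of the kernel projection of R\<close>

lemma select_columns_mult: "select_columns \<iota> (M ** N) = M ** select_columns \<iota> N"
  by (simp add: select_columns_def matrix_matrix_mult_def vec_eq_iff)

lemma select_columns_mult_select_rows:
  fixes X :: "real^'m^'n" and Y :: "real^'l^'m" and \<iota> :: "'k::finite \<Rightarrow> 'm"
  assumes "inj \<iota>" and "\<And>i. i \<notin> range \<iota> \<Longrightarrow> Y $ i = 0"
  shows "select_columns \<iota> X ** select_rows \<iota> Y = X ** Y"
proof -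
  have "(\<Sum>i\<in>UNIV. X $ a $ i * Y $ i $ b) = (\<Sum>j\<in>UNIV. X $ a $ \<iota> j * Y $ \<iota> j $ b)" for a b
  proof -
    have "(\<Sum>i\<in>UNIV. X $ a $ i * Y $ i $ b) = (\<Sum>i\<in>range \<iota>. X $ a $ i * Y $ i $ b)"
      by (rule sum.mono_neutral_right) (auto simp: assms(2))
    also have "\<dots> = (\<Sum>j\<in>UNIV. X $ a $ \<iota> j * Y $ \<iota> j $ b)"
      using \<open>inj \<iota>\<close> by (simp add: sum.reindex)
    finally show ?thesis .
  qed
  then show ?thesis
    by (simp add: select_columns_def select_rows_def matrix_matrix_mult_def vec_eq_iff)
qed

lemma matrix_inv_mult:
  fixes M :: "real^'n^'n"
  assumes "invertible M"
  shows "matrix_inv M ** M = mat 1"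
  using someI_ex[OF assms[unfolded invertible_def]] by (simp add: matrix_inv_def)

text \<open>
  As \<open>T0 E\<close> has no rows outside the block, multiplying it by the inverse of \<open>T0\<close> involves only the columns
  collected in \<open>G\<close>.  Since \<open>\<Upsilon>\<close> has full row rank, it can be cancelled from \<open>R E = 0\<close>.
\<close>

lemma kernel_factorization:
  fixes R T0 :: "real^'m^'m" and \<iota> :: "'k::finite \<Rightarrow> 'm" and \<Upsilon> :: "real^'m^'k"
  assumes "inj \<iota>" and "invertible T0"
    and "\<And>i. i \<notin> range \<iota> \<Longrightarrow> (T0 ** (mat 1 - pinv R ** R)) $ i = 0"
    and \<Upsilon>: "\<Upsilon> = select_rows \<iota> (T0 ** (mat 1 - pinv R ** R))" and "rank \<Upsilon> = CARD('k)"
    and G: "G = select_columns \<iota> (matrix_inv T0)"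
  shows "mat 1 - pinv R ** R = G ** \<Upsilon>" and "R ** G = 0"
proof -
  have "G ** \<Upsilon> = matrix_inv T0 ** (T0 ** (mat 1 - pinv R ** R))"
    unfolding G \<Upsilon> by (rule select_columns_mult_select_rows) (use assms in auto)
  then show E: "mat 1 - pinv R ** R = G ** \<Upsilon>"
    by (simp add: matrix_mul_assoc matrix_inv_mult[OF \<open>invertible T0\<close>])
  have "surj ((*v) \<Upsilon>)" using assms(5) full_rank_surjective[of \<Upsilon>] by simp
  then obtain W where W: "\<Upsilon> ** W = mat 1" using matrix_right_invertible_surjective[of \<Upsilon>] by blast
  have "R ** (G ** \<Upsilon>) = R - R ** pinv R ** R"
    by (simp add: E[symmetric] matrix_mult_diff_right matrix_mul_assoc)
  then have "R ** (G ** \<Upsilon>) = 0" using is_pinv_pinv[of R] by (simp add: is_pinv_def)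
  moreover have "R ** G = R ** (G ** \<Upsilon>) ** W"
    by (simp add: matrix_mul_assoc[symmetric] W)
  ultimately show "R ** G = 0" by (simp add: matrix_mult_zero_left)
qed

lemma pinv_projection_commute:
  assumes "transpose R = R"
  shows "R ** pinv R = pinv R ** R"
proof -
  have "transpose (pinv R ** R) = R ** pinv R"
    using assms by (simp add: matrix_transpose_mul transpose_pinv)
  then show ?thesis using is_pinv_pinv[of R] by (simp add: is_pinv_def)
qed

section \<open>Optimality of the irregular controller\<close>

lemma riccati_derivative_eq_iff:
  fixes D :: "'a::ab_group_add"
  shows "0 = D + a + b + c - d \<longleftrightarrow> D = - a - b - c + d"
  by (auto simp: algebra_simps)

lemma solves_riccati_derivative:
  assumes "solves_riccati A B Q R H t0 T P" and "t \<in> {t0..T}"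
  shows "(P has_vector_derivative - (transpose A ** P t) - P t ** A - Q
    + P t ** (B ** pinv R ** transpose B) ** P t) (at t within {t0..T})"
  using assms by (auto simp: solves_riccati_def riccati_derivative_eq_iff matrix_mul_assoc)

text \<open>
  The costate \<open>S x\<close> of the closed loop, with \<open>S = P + P1\<close>.  The state \<open>x\<close> is in general not differentiable,
  but \<open>S x\<close> is: in its increments the irregular part \<open>B0 u1\<close> of the velocity is annihilated by \<open>S\<close>.
\<close>

lemma irregular_solution_optimal:
  fixes A :: "real^'n^'n" and B :: "real^'m^'n" and G :: "real^'k^'m"
  assumes Q: "psd Q" and H: "psd H" and R: "psd R" and "t0 \<le> T"
    and P: "solves_riccati A B Q R H t0 T P"
    and E: "mat 1 - pinv R ** R = G ** \<Upsilon>" and RG: "R ** G = 0"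
    and A0: "\<And>t. A0 t = A - B ** pinv R ** transpose B ** P t"
    and D0: "D0 = - (B ** pinv R ** transpose B)" and B0: "B0 = B ** G"
    and C0: "\<And>t. transpose (C0 t) = P t ** B0"
    and irr: "irregular_solution A0 D0 B0 C0 t0 T P1"
    and steer: "steers_to_kernel A0 D0 B0 t0 T P1 x0 u1 x"
    and u: "u = (\<lambda>t. - ((pinv R ** transpose B ** (P t + P1 t)) *v x t) + G *v u1 t)"
  shows "lq_optimal A B Q R H t0 T x0 x u"
    and "lq_cost Q R H t0 T x u = x0 \<bullet> ((P t0 + P1 t0) *v x0)"
proof -
  define M where "M = B ** pinv R ** transpose B"
  define S where "S t = P t + P1 t" for t
  have "psd M" unfolding M_def by (intro psd_congruence psd_pinv R)
  then have symM: "transpose M = M" by (simp add: psd_def)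
  have P': "(P has_vector_derivative - (transpose A ** P t) - P t ** A - Q + P t ** M ** P t)
      (at t within {t0..T})" if "t \<in> {t0..T}" for t
    unfolding M_def by (rule solves_riccati_derivative[OF P that])
  have symP: "transpose (P t) = P t" if "t \<in> {t0..T}" for t
    by (rule riccati_symmetric[OF P' _ symM _ that])
       (use Q H P in \<open>auto simp: psd_def solves_riccati_def\<close>)
  have symS: "transpose (S t) = S t" if "t \<in> {t0..T}" for t
    using irr that by (simp add: S_def transpose_add symP irregular_solution_def)
  have S': "(S has_vector_derivative - (transpose A ** S t) - S t ** A - Q + S t ** M ** S t)
      (at t within {t0..T})" if t: "t \<in> {t0..T}" for t
  proof -
    obtain P1' where P1': "(P1 has_vector_derivative P1') (at t within {t0..T})"
      and eq: "0 = P1' + P1 t ** A0 t + transpose (A0 t) ** P1 t + P1 t ** D0 ** P1 t"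
      using irr t unfolding irregular_solution_def solves_riccati1_def by blast
    have "P1' = - (P1 t ** A0 t) - transpose (A0 t) ** P1 t - 0 + - (P1 t ** D0 ** P1 t)"
      by (subst riccati_derivative_eq_iff[symmetric]) (simp add: eq[symmetric])
    then have P1'_eq: "P1' = - (P1 t ** A0 t) - transpose (A0 t) ** P1 t - P1 t ** D0 ** P1 t" by simp
    have "transpose (M ** P t) = P t ** M" by (simp add: matrix_transpose_mul symM symP[OF t])
    then show ?thesis
      unfolding S_def
      using has_vector_derivative_add[OF P'[OF t] P1']
      by (elim has_vector_derivative_eq_rhs)
         (simp add: P1'_eq A0 D0 M_def[symmetric] transpose_diff matrix_mult_bilinear
           matrix_mul_assoc algebra_simps)
  qed
  have contS: "continuous_on {t0..T} S" by (rule continuous_on_vector_derivative[OF S'])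
  have B0S: "transpose B0 ** S t = 0" if t: "t \<in> {t0..T}" for t
  proof -
    have "C0 t = transpose B0 ** P t"
      by (metis C0 matrix_transpose_mul symP[OF t] transpose_transpose)
    moreover have "0 = C0 t + transpose B0 ** P1 t"
      using irr t unfolding irregular_solution_def by blast
    ultimately show ?thesis by (simp add: S_def matrix_mult_add_right)
  qed
  have SB0: "S t *v (B0 *v w) = 0" if t: "t \<in> {t0..T}" for t w
  proof -
    have "S t ** B0 = transpose (transpose B0 ** S t)" by (simp add: matrix_transpose_mul symS[OF t])
    also have "\<dots> = 0" unfolding B0S[OF t] by (simp add: transpose_def vec_eq_iff)
    finally show ?thesis by (simp add: matrix_vector_mul_assoc)
  qed
  \<comment> \<open>\<open>E B' S = \<Upsilon>' B0' S = 0\<close>: on the range of \<open>S\<close>, the map \<open>B'\<close> takes values in the range of \<open>R\<close>.\<close>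
  have RRBS: "R ** pinv R ** transpose B ** S t = transpose B ** S t" if t: "t \<in> {t0..T}" for t
  proof -
    have "transpose (mat 1 - pinv R ** R) = mat 1 - pinv R ** R"
      using is_pinv_pinv[of R] by (simp add: is_pinv_def transpose_diff)
    then have "(mat 1 - pinv R ** R) ** (transpose B ** S t) = transpose \<Upsilon> ** (transpose B0 ** S t)"
      unfolding E B0 by (simp add: matrix_transpose_mul matrix_mul_assoc)
    also have "\<dots> = 0" by (simp add: B0S[OF t] matrix_mult_zero_right)
    finally have "pinv R ** R ** (transpose B ** S t) = transpose B ** S t"
      by (simp add: matrix_mult_bilinear)
    then show ?thesis
      using R by (simp add: pinv_projection_commute psd_def matrix_mul_assoc)
  qed
  have sol: "solves_linear_ode (\<lambda>t. A0 t + D0 ** P1 t) B0 t0 T x0 u1 x"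
    and u1: "square_integrable t0 T u1" and P1T: "P1 T *v x T = 0"
    using steer by (auto simp: steers_to_kernel_def)
  have F: "A0 t + D0 ** P1 t = A - M ** S t" for t
    by (simp add: A0 D0 M_def[symmetric] S_def matrix_mult_bilinear)
  have contx: "continuous_on {t0..T} x" by (rule solves_linear_ode_continuous[OF sol \<open>t0 \<le> T\<close>])
  have xt0: "x t0 = x0" by (rule solves_linear_ode_initial[OF sol \<open>t0 \<le> T\<close>])
  define g where "g t = (A - M ** S t) *v x t + B0 *v u1 t" for t
  have g: "(g has_integral (x t - x t0)) {t0..t}" if "t \<in> {t0..T}" for t
    using sol that by (simp add: solves_linear_ode_def F g_def[abs_def] xt0)
  have contF: "continuous_on {t0..T} (\<lambda>t. (A - M ** S t) *v x t)"
    by (intro continuous_on_matrix_vector continuous_on_diff continuous_on_matrix_mult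
        continuous_on_const contS contx)
  have g_abs: "g absolutely_integrable_on {t0..T}"
    unfolding g_def[abs_def]
    by (intro square_integrable_absolutely_integrable square_integrable_add
        square_integrable_matrix_vector u1 square_integrable_continuous contF)
  have x: "lq_admissible A B t0 T x0 x u"
    unfolding lq_admissible_def
  proof
    have "continuous_on {t0..T} (\<lambda>t. - ((pinv R ** transpose B ** S t) *v x t))"
      by (intro continuous_on_minus continuous_on_matrix_vector continuous_on_matrix_mult
          continuous_on_const contS contx)
    then show "square_integrable t0 T u"
      unfolding u S_def[symmetric]
      by (intro square_integrable_add square_integrable_matrix_vector u1 square_integrable_continuous)
    have "A *v x t + B *v u t = (A0 t + D0 ** P1 t) *v x t + B0 *v u1 t" for t
      by (simp add: F u S_def[symmetric] M_def B0 algebra_simps matrix_vector_mul_assoc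
          matrix_vector_minus_right matrix_mul_assoc)
    then show "solves_linear_ode (\<lambda>_. A) B t0 T x0 u x"
      using sol by (simp add: solves_linear_ode_def)
  qed
  define p where "p t = S t *v x t" for t
  have contp: "continuous_on {t0..T} p"
    unfolding p_def by (intro continuous_on_matrix_vector contS contx)
  define r where "r t = - (transpose A *v p t) - Q *v x t" for t
  have contr: "continuous_on {t0..T} r"
    unfolding r_def
    by (intro continuous_on_diff continuous_on_minus continuous_on_matrix_vector continuous_on_const
        contp contx)
  have p_int: "p t = p t0 + integral {t0..t} r" if t: "t \<in> {t0..T}" for t
  proof -
    let ?S' = "\<lambda>s. - (transpose A ** S s) - S s ** A - Q + S s ** M ** S s"
    have sub: "{t0..t} \<subseteq> {t0..T}" and "t0 \<le> t" using t by auto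
    have "((\<lambda>s. ?S' s *v x s + S s *v g s) has_integral (S t *v x t - S t0 *v x t0)) {t0..t}"
    proof (rule has_integral_product_rule[OF bounded_bilinear_matrix_vector \<open>t0 \<le> t\<close>])
      show "(S has_vector_derivative ?S' s) (at s within {t0..t})" if "s \<in> {t0..t}" for s
        using that sub by (intro has_vector_derivative_within_subset[OF S' sub]) auto
      have "continuous_on {t0..T} ?S'"
        by (intro continuous_on_add continuous_on_diff continuous_on_minus continuous_on_matrix_mult
            continuous_on_const contS)
      then show "continuous_on {t0..t} ?S'" using sub by (rule continuous_on_subset)
      show "(g has_integral (x s - x t0)) {t0..s}" if "s \<in> {t0..t}" for s
        using that t by (intro g) auto
      show "g absolutely_integrable_on {t0..t}"
        using g_abs sub by (rule absolutely_integrable_on_subinterval)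
    qed
    moreover have "?S' s *v x s + S s *v g s = r s" if "s \<in> {t0..t}" for s
    proof -
      have "s \<in> {t0..T}" using that sub by auto
      then show ?thesis
        by (simp add: g_def r_def p_def algebra_simps SB0 matrix_vector_minus_left
            matrix_vector_mul_assoc matrix_mul_assoc)
           (simp add: matrix_vector_mul_assoc[symmetric] SB0)
    qed
    ultimately have "(r has_integral (p t - p t0)) {t0..t}"
      unfolding p_def by (rule has_integral_eq[rotated])
    then show ?thesis by (simp add: integral_unique)
  qed
  have "costate A Q H t0 T x p"
    unfolding costate_def
  proof (intro conjI ballI)
    fix t assume t: "t \<in> {t0..T}"
    have "((\<lambda>t. p t0 + integral {t0..t} r) has_vector_derivative 0 + r t) (at t within {t0..T})"
      by (intro has_vector_derivative_add has_vector_derivative_const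
          integral_has_vector_derivative contr t)
    then show "(p has_vector_derivative - (transpose A *v p t) - Q *v x t) (at t within {t0..T})"
      using has_vector_derivative_transform[OF t p_int] by (simp add: r_def)
  next
    show "p T = H *v x T"
      using P P1T by (simp add: p_def S_def algebra_simps solves_riccati_def)
  qed
  moreover have "R *v u t = - (transpose B *v p t)" if t: "t \<in> {t0..T}" for t
  proof -
    have "R *v u t = - ((R ** pinv R ** transpose B ** S t) *v x t) + (R ** G) *v u1 t"
      by (simp add: u S_def algebra_simps matrix_vector_minus_right matrix_vector_mul_assoc matrix_mul_assoc)
    then show ?thesis by (simp add: RRBS[OF t] RG p_def matrix_vector_mul_assoc)
  qed
  ultimately show "lq_optimal A B Q R H t0 T x0 x u"
    and "lq_cost Q R H t0 T x u = x0 \<bullet> ((P t0 + P1 t0) *v x0)"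
    using lq_optimal_of_costate[OF Q R H \<open>t0 \<le> T\<close> x]
    by (simp_all add: p_def xt0 S_def inner_commute)
qed

section \<open>Necessity of the irregular Riccati solution\<close>

text \<open>
  \<open>V\<close> below consists of the directions orthogonal to every costate that belongs to an optimal pair, from any
  initial state.  It contains the range of \<open>B G\<close>, and it lies in the kernel of \<open>Q\<close> because from an
  initial state in \<open>V\<close> the optimal cost is zero.  Invariance under \<open>A\<close> follows from the costate equation
  exactly because of the latter.
\<close>

lemma lq_solvable_controllable_kernel:
  fixes A :: "real^'n^'n" and B :: "real^'m^'n" and G :: "real^'k^'m"
  assumes Q: "psd Q" and R: "psd R" and H: "psd H" and "t0 < T"
    and solv: "lq_solvable A B Q R H t0 T" and RG: "R ** G = 0"
    and c: "c \<in> controllable_subspace A (B ** G)"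
  shows "Q *v c = 0"
proof -
  define opt where "opt x0 x u p \<longleftrightarrow> lq_optimal A B Q R H t0 T x0 x u \<and> costate A Q H t0 T x p \<and>
    (\<forall>t\<in>{t0..T}. transpose (B ** G) *v p t = 0) \<and> lq_cost Q R H t0 T x u = p t0 \<bullet> x0" for x0 x u p
  have ex: "\<exists>x u p. opt x0 x u p" for x0
  proof -
    obtain u x where xu: "lq_optimal A B Q R H t0 T x0 x u"
      using solv[unfolded lq_solvable_def, rule_format, of x0] by (elim exE)
    show ?thesis
      by (rule lq_optimal_costate[OF Q R H \<open>t0 < T\<close> xu RG]) (use xu opt_def in blast)
  qed
  define V where "V = {c. \<forall>x0 x u p. opt x0 x u p \<longrightarrow> (\<forall>t\<in>{t0..T}. p t \<bullet> c = 0)}"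
  have QV: "Q *v c = 0" if "c \<in> V" for c
  proof -
    obtain x u p where o: "opt c x u p" using ex by blast
    then have "lq_cost Q R H t0 T x u = 0"
      using \<open>c \<in> V\<close> \<open>t0 < T\<close> by (auto simp: opt_def V_def)
    have adm: "lq_admissible A B t0 T c x u" using o by (simp add: opt_def lq_optimal_def)
    then have sol: "solves_linear_ode (\<lambda>_. A) B t0 T c u x" by (simp add: lq_admissible_def)
    have contx: "continuous_on {t0..T} x" and xt0: "x t0 = c"
      using solves_linear_ode_continuous[OF sol] solves_linear_ode_initial[OF sol] \<open>t0 < T\<close> by auto
    have cont: "continuous_on {t0..T} (\<lambda>t. x t \<bullet> (Q *v x t))"
      by (intro continuous_on_inner continuous_on_matrix_vector continuous_on_const contx)
    have "integral {t0..T} (\<lambda>t. x t \<bullet> (Q *v x t)) \<le>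
        integral {t0..T} (\<lambda>t. x t \<bullet> (Q *v x t) + u t \<bullet> (R *v u t))"
      using \<open>t0 < T\<close>
      by (intro integral_le integrable_continuous_real cont lq_polar_integrable[OF adm adm])
         (auto simp: psd_nonneg[OF R])
    also have "\<dots> \<le> 0"
      using \<open>lq_cost Q R H t0 T x u = 0\<close> psd_nonneg[OF H, of "x T"] by (simp add: lq_cost_def)
    finally have "integral {t0..T} (\<lambda>t. x t \<bullet> (Q *v x t)) \<le> 0" .
    moreover have "integral {t0..T} (\<lambda>t. x t \<bullet> (Q *v x t)) \<ge> 0"
      by (intro Henstock_Kurzweil_Integration.integral_nonneg integrable_continuous_real cont
          psd_nonneg[OF Q])
    ultimately have "integral {t0..T} (\<lambda>t. x t \<bullet> (Q *v x t)) = 0" by (rule order_antisym)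
    then have "x t0 \<bullet> (Q *v x t0) = 0"
      using integral_eq_0_iff[OF cont \<open>t0 < T\<close> psd_nonneg[OF Q]] \<open>t0 < T\<close> by simp
    then show ?thesis using psd_eq_0[OF Q] xt0 by simp
  qed
  have "controllable_subspace A (B ** G) \<subseteq> V"
  proof (rule controllable_subspace_minimal)
    show "subspace V" by (rule subspaceI) (auto simp: V_def inner_add_right)
    show "(B ** G) *v w \<in> V" for w
      unfolding V_def opt_def
      by (clarsimp simp: inner_transpose_matrix_vector[symmetric])
    show "A *v c \<in> V" if "c \<in> V" for c
      unfolding V_def
    proof (intro CollectI allI impI ballI)
      fix x0 x u p t assume o: "opt x0 x u p" and t: "t \<in> {t0..T}"
      have "(- (transpose A *v p t) - Q *v x t) \<bullet> c = 0"
      proof (rule inner_eq_0_derivative[OF \<open>t0 < T\<close> _ _ t])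
        show "(p has_vector_derivative - (transpose A *v p s) - Q *v x s) (at s within {t0..T})"
          if "s \<in> {t0..T}" for s using o that by (simp add: opt_def costate_def)
        show "p s \<bullet> c = 0" if "s \<in> {t0..T}" for s using o that \<open>c \<in> V\<close> by (auto simp: V_def)
      qed
      moreover have "(Q *v x t) \<bullet> c = 0"
        using QV[OF \<open>c \<in> V\<close>] psd_sym[OF Q, of c "x t"] by (simp add: inner_commute)
      ultimately show "p t \<bullet> (A *v c) = 0"
        by (simp add: inner_diff_left inner_transpose_matrix_vector)
    qed
  qed
  then show ?thesis using c QV by blast
qed

text \<open>
  With \<open>Pr\<close> a projection onto an \<open>A\<close>-invariant subspace in the kernel of \<open>Q\<close>, the product \<open>S Pr\<close> solves a
  homogeneous linear equation.
\<close>

lemma riccati_vanishes_on_controllable: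
  fixes A :: "real^'n^'n"
  assumes S: "\<And>t. t \<in> {a..b} \<Longrightarrow> (S has_vector_derivative
      - (transpose A ** S t) - S t ** A - Q + S t ** M ** S t) (at t within {a..b})"
    and "a \<le> b" and Sb: "S b ** Pr = 0" and QPr: "Q ** Pr = 0" and APr: "Pr ** (A ** Pr) = A ** Pr"
    and t: "t \<in> {a..b}"
  shows "S t ** Pr = 0"
proof (rule linear_matrix_ode_eq_0[where D = "\<lambda>t. S t ** Pr" and c = b and t = t])
  have cont: "continuous_on {a..b} S" by (rule continuous_on_vector_derivative[OF S])
  show "continuous_on {a..b} (\<lambda>t. S t ** M - transpose A)" "continuous_on {a..b} (\<lambda>t. - (A ** Pr))"
    by (intro continuous_on_diff continuous_on_matrix_mult continuous_on_const cont)+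
  show "((\<lambda>t. S t ** Pr) has_vector_derivative (S s ** M - transpose A) ** (S s ** Pr) +
      S s ** Pr ** - (A ** Pr)) (at s within {a..b})" if "s \<in> {a..b}" for s
  proof -
    have "((\<lambda>t. S t ** Pr) has_vector_derivative
        (- (transpose A ** S s) - S s ** A - Q + S s ** M ** S s) ** Pr) (at s within {a..b})"
      by (rule bounded_linear.has_vector_derivative[OF _ S[OF that]])
         (rule bounded_bilinear.bounded_linear_left[OF bounded_bilinear_matrix_matrix])
    then show ?thesis
      by (rule has_vector_derivative_eq_rhs)
         (simp add: matrix_mult_bilinear matrix_mul_assoc[symmetric] APr QPr)
  qed
qed (use \<open>a \<le> b\<close> Sb t in auto)

text \<open>
  Here \<open>P1 = S - P\<close>, where \<open>S\<close> has the terminal value \<open>H1\<close>, the weight minimised over the controllable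
  subspace of \<open>(A, B0)\<close>.  As \<open>S\<close> vanishes on that subspace, motions inside it do not disturb the closed
  loop, and they can be used to correct the end point.
\<close>

lemma irregular_solution_exists:
  fixes A :: "real^'n^'n" and B :: "real^'m^'n" and B0 :: "real^'k^'n"
  assumes Q: "psd Q" and H: "psd H" and R: "psd R" and "t0 < T"
    and P: "solves_riccati A B Q R H t0 T P"
    and A0: "\<And>t. A0 t = A - B ** pinv R ** transpose B ** P t"
    and D0: "D0 = - (B ** pinv R ** transpose B)"
    and C0: "\<And>t. transpose (C0 t) = P t ** B0"
    and QN: "\<And>c. c \<in> controllable_subspace A B0 \<Longrightarrow> Q *v c = 0"
  obtains P1 where "irregular_solution A0 D0 B0 C0 t0 T P1"
proof -
  have "t0 \<le> T" using \<open>t0 < T\<close> by simp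
  define M where "M = B ** pinv R ** transpose B"
  have "psd M" unfolding M_def by (intro psd_congruence psd_pinv R)
  then have symM: "transpose M = M" by (simp add: psd_def)
  have symQ: "transpose Q = Q" using Q by (simp add: psd_def)
  have P': "(P has_vector_derivative - (transpose A ** P t) - P t ** A - Q + P t ** M ** P t)
      (at t within {t0..T})" if "t \<in> {t0..T}" for t
    unfolding M_def by (rule solves_riccati_derivative[OF P that])
  have PT: "P T = H" using P by (simp add: solves_riccati_def)
  have symP: "transpose (P t) = P t" if "t \<in> {t0..T}" for t
    by (rule riccati_symmetric[OF P' symQ symM _ that]) (use H PT in \<open>auto simp: psd_def\<close>)
  define N where "N = controllable_subspace A B0"
  obtain Pr :: "real^'n^'n" where symPr: "transpose Pr = Pr" and PrN: "\<And>x. Pr *v x \<in> N"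
    and Pr_id: "\<And>x. x \<in> N \<Longrightarrow> Pr *v x = x"
    using orthogonal_projection_matrix[OF subspace_controllable_subspace[of A B0]] unfolding N_def by metis
  have APr: "Pr ** (A ** Pr) = A ** Pr"
  proof -
    have "A *v (Pr *v x) \<in> N" for x
      using controllable_subspace_invariant PrN unfolding N_def by blast
    then show ?thesis using Pr_id by (simp add: matrix_eq matrix_vector_mul_assoc[symmetric])
  qed
  have PrB0: "Pr *v (B0 *v w) = B0 *v w" for w
    by (rule Pr_id) (simp add: N_def range_subset_controllable_subspace)
  have QPr: "Q ** Pr = 0"
    using QN PrN by (simp add: matrix_eq matrix_vector_mul_assoc[symmetric] N_def)
  obtain H1 where H1: "psd H1" "H1 ** Pr = 0" and H1H: "\<And>x. \<exists>w. H1 *v x = H *v (x + Pr *v w)"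
    by (rule psd_schur_complement[OF H, of Pr]) (rule that)
  obtain S X :: "real \<Rightarrow> real^'n^'n" where ST: "S T = H1"
    and S': "\<And>t. t \<in> {t0..T} \<Longrightarrow> (S has_vector_derivative
        - (transpose A ** S t) - S t ** A - Q + S t ** M ** S t) (at t within {t0..T})"
    and X': "\<And>t. t \<in> {t0..T} \<Longrightarrow> (X has_vector_derivative (A - M ** S t) ** X t) (at t within {t0..T})"
    and invX: "\<And>t. t \<in> {t0..T} \<Longrightarrow> invertible (X t)"
    by (rule riccati_exists[OF Q \<open>psd M\<close> H1(1) \<open>t0 \<le> T\<close>, of A]) blast
  have symS: "transpose (S t) = S t" if "t \<in> {t0..T}" for t
    by (rule riccati_symmetric[OF S' symQ symM _ that]) (use H1 ST in \<open>auto simp: psd_def\<close>)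
  have SPr: "S t ** Pr = 0" if "t \<in> {t0..T}" for t
    by (rule riccati_vanishes_on_controllable[OF S' \<open>t0 \<le> T\<close> _ QPr APr that]) (simp_all add: ST H1)
  have F: "A0 t + D0 ** (S t - P t) = A - M ** S t" for t
    by (simp add: A0 D0 M_def[symmetric] matrix_mult_bilinear)
  have steer: "\<exists>u1 x. steers_to_kernel A0 D0 B0 t0 T (\<lambda>t. S t - P t) x0 u1 x" for x0
  proof -
    have "t0 \<in> {t0..T}" "T \<in> {t0..T}" using \<open>t0 \<le> T\<close> by auto
    obtain Z where Z: "X t0 ** Z = mat 1"
      using invX[OF \<open>t0 \<in> {t0..T}\<close>] unfolding invertible_def by blast
    define y where "y t = X t *v (Z *v x0)" for t
    have y0: "y t0 = x0" by (simp add: y_def matrix_vector_mul_assoc Z)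
    have y': "(y has_vector_derivative (A - M ** S t) *v y t) (at t within {t0..T})"
      if "t \<in> {t0..T}" for t
      using bounded_linear.has_vector_derivative[OF bounded_bilinear.bounded_linear_left[OF bounded_bilinear_matrix_vector] X'[OF that], of "Z *v x0"]
      by (simp only: y_def[abs_def] matrix_vector_mul_assoc matrix_mul_assoc)
    \<comment> \<open>The displacement inside the controllable subspace that minimises the terminal cost at \<open>y T\<close>.\<close>
    obtain w where w: "H1 *v y T = H *v (y T + Pr *v w)" using H1H by blast
    obtain \<phi> z where cont\<phi>: "continuous_on {t0..T} \<phi>" and z0: "z t0 = 0" and zT: "z T = Pr *v w"
      and z': "\<And>t. t \<in> {t0..T} \<Longrightarrow> (z has_vector_derivative A *v z t + B0 *v \<phi> t) (at t within {t0..T})"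
      using controllable_subspace_reachable[OF \<open>t0 < T\<close> PrN[unfolded N_def]] by blast
    \<comment> \<open>The trajectory \<open>z\<close> starts in the controllable subspace and never leaves it: its component orthogonal
      to that subspace solves a homogeneous linear equation.\<close>
    define e where "e t = z t - Pr *v z t" for t
    obtain K where K: "\<And>v. norm ((A - Pr ** A) *v v) \<le> norm v * K"
      using bounded_linear.bounded[OF matrix_vector_mul_bounded_linear] by blast
    have e0: "e t = 0" if t: "t \<in> {t0..T}" for t
    proof (rule gronwall_zero[where f = e and c = t0 and t = t and K = K])
      show "(e has_vector_derivative (A - Pr ** A) *v e s) (at s within {t0..T})" if "s \<in> {t0..T}" for s
      proof -
        have "A *v (Pr *v z s) = Pr *v (A *v (Pr *v z s))"
          by (simp add: matrix_vector_mul_assoc APr)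
        then show ?thesis
          unfolding e_def
          using has_vector_derivative_diff[OF z'[OF that]
              bounded_linear.has_vector_derivative[OF matrix_vector_mul_bounded_linear z'[OF that]], of Pr]
          by (elim has_vector_derivative_eq_rhs)
             (simp add: algebra_simps PrB0 matrix_vector_mul_assoc[symmetric])
      qed
      show "norm ((A - Pr ** A) *v e s) \<le> K * norm (e s)" for s using K[of "e s"] by (simp add: mult.commute)
      have "Pr *v (0 :: real^'n) = 0" by simp
      then show "e t0 = 0" using z0 by (simp add: e_def)
    qed (use t \<open>t0 \<le> T\<close> in auto)
    have Sz: "S t *v z t = 0" if "t \<in> {t0..T}" for t
    proof -
      have "S t *v z t = (S t ** Pr) *v z t"
        using e0[OF that] by (simp add: e_def matrix_vector_mul_assoc[symmetric])
      then show ?thesis by (simp add: SPr[OF that])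
    qed
    have "steers_to_kernel A0 D0 B0 t0 T (\<lambda>t. S t - P t) x0 \<phi> (\<lambda>t. y t + z t)"
      unfolding steers_to_kernel_def F
    proof (intro conjI solves_linear_odeI_derivative square_integrable_continuous cont\<phi>)
      show "((\<lambda>t. y t + z t) has_vector_derivative (A - M ** S t) *v (y t + z t) + B0 *v \<phi> t)
          (at t within {t0..T})" if "t \<in> {t0..T}" for t
        using has_vector_derivative_add[OF y'[OF that] z'[OF that]]
        by (rule has_vector_derivative_eq_rhs)
           (simp add: algebra_simps matrix_vector_mul_assoc[symmetric] Sz[OF that])
      show "y t0 + z t0 = x0" by (simp add: y0 z0)
      have "H1 *v (Pr *v w) = 0" by (simp add: matrix_vector_mul_assoc H1)
      then show "(S T - P T) *v (y T + z T) = 0"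
        using w by (simp add: ST PT zT algebra_simps)
    qed
    then show ?thesis by blast
  qed
  have "irregular_solution A0 D0 B0 C0 t0 T (\<lambda>t. S t - P t)"
    unfolding irregular_solution_def solves_riccati1_def
  proof (intro conjI ballI allI steer)
    fix t assume t: "t \<in> {t0..T}"
    show "transpose (S t - P t) = S t - P t" by (simp add: transpose_diff symS[OF t] symP[OF t])
    have "C0 t = transpose B0 ** P t"
      by (metis C0 matrix_transpose_mul symP[OF t] transpose_transpose)
    moreover have "S t ** B0 = 0"
    proof -
      have "S t *v (B0 *v w) = (S t ** Pr) *v (B0 *v w)" for w
        by (simp add: matrix_vector_mul_assoc[symmetric] PrB0)
      then show ?thesis by (simp add: matrix_eq SPr[OF t] matrix_vector_mul_assoc[symmetric])
    qed
    then have "transpose B0 ** S t = transpose (0 :: real^'k^'n)"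
      by (metis matrix_transpose_mul symS[OF t])
    then have "transpose B0 ** S t = 0" by (simp add: transpose_def vec_eq_iff)
    ultimately show "0 = C0 t + transpose B0 ** (S t - P t)"
      by (simp add: matrix_mult_diff_right)
    let ?D = "(- (transpose A ** S t) - S t ** A - Q + S t ** M ** S t) -
      (- (transpose A ** P t) - P t ** A - Q + P t ** M ** P t)"
    have "transpose (M ** P t) = P t ** M" by (simp add: matrix_transpose_mul symM symP[OF t])
    then have "0 = ?D + (S t - P t) ** A0 t + transpose (A0 t) ** (S t - P t)
        + (S t - P t) ** D0 ** (S t - P t)"
      by (simp add: A0 D0 M_def[symmetric] transpose_diff matrix_mult_bilinear
           matrix_mul_assoc algebra_simps)
    then show "\<exists>P1'. ((\<lambda>t. S t - P t) has_vector_derivative P1') (at t within {t0..T}) \<and>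
        0 = P1' + (S t - P t) ** A0 t + transpose (A0 t) ** (S t - P t) + (S t - P t) ** D0 ** (S t - P t)"
      using has_vector_derivative_diff[OF S'[OF t] P'[OF t]] by blast
  qed
  then show ?thesis by (rule that)
qed

theorem theorem2:
  fixes A :: "real^'n^'n" and B :: "real^'m^'n"
    and Q H :: "real^'n^'n" and R :: "real^'m^'m"
    and t0 T :: real
    and P :: "real \<Rightarrow> real^'n^'n"
    and T0 :: "real^'m^'m"
    and \<iota> :: "'k::finite \<Rightarrow> 'm::finite"
    and \<Upsilon> :: "real^'m^'k"
    and A0 :: "real \<Rightarrow> real^'n^'n" and D0 :: "real^'n^'n"
    and G0 :: "real^'k^'m" and B0 :: "real^'k^'n"
    and C0 :: "real \<Rightarrow> real^'n^'k"
  assumes "psd Q" and "psd H" and "psd R"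
    and "t0 < T"
    and "solves_riccati A B Q R H t0 T P"
    and "rank R < CARD('m)" and "CARD('k) = CARD('m) - rank R"
    and "inj \<iota>"
    and "invertible T0"
    and "\<forall>i. i \<notin> range \<iota> \<longrightarrow> (T0 ** (mat 1 - pinv R ** R)) $ i = 0"
    and "\<Upsilon> = select_rows \<iota> (T0 ** (mat 1 - pinv R ** R))"
    and "rank \<Upsilon> = CARD('k)"
    and "\<forall>t. A0 t = A - B ** pinv R ** transpose B ** P t"
    and "D0 = - (B ** pinv R ** transpose B)"
    and "G0 = select_columns \<iota> (matrix_inv T0)"
    and "\<forall>t. transpose (C0 t) =
           select_columns \<iota> (P t ** B ** (mat 1 - pinv R ** R) ** matrix_inv T0)"
    and "B0 = select_columns \<iota> (B ** (mat 1 - pinv R ** R) ** matrix_inv T0)"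
    and "\<not> (\<forall>t\<in>{t0..T}. range ((*v) (transpose B ** P t)) \<subseteq> range ((*v) R))"
  shows "(lq_solvable A B Q R H t0 T \<longleftrightarrow> (\<exists>P1. irregular_solution A0 D0 B0 C0 t0 T P1)) \<and>
    (\<forall>P1 x0 u1 x.
       irregular_solution A0 D0 B0 C0 t0 T P1 \<and> steers_to_kernel A0 D0 B0 t0 T P1 x0 u1 x \<longrightarrow>
       (let u = (\<lambda>t. - ((pinv R ** transpose B ** (P t + P1 t)) *v x t) + G0 *v u1 t)
        in lq_optimal A B Q R H t0 T x0 x u \<and>
           lq_cost Q R H t0 T x u = x0 \<bullet> ((P t0 + P1 t0) *v x0)))"
proof -
  have A0: "A0 t = A - B ** pinv R ** transpose B ** P t" for t using assms by simp
  have "t0 \<le> T" using \<open>t0 < T\<close> by simp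
  have E: "mat 1 - pinv R ** R = G0 ** \<Upsilon>" and RG: "R ** G0 = 0"
    by (rule kernel_factorization[of \<iota> T0 R \<Upsilon> G0]; use assms in auto)+
  have EG: "(mat 1 - pinv R ** R) ** G0 = G0"
    by (simp add: matrix_mult_diff_left matrix_mul_assoc[symmetric] RG matrix_mult_zero_right)
  have B0: "B0 = B ** G0"
    unfolding assms(17) select_columns_mult assms(15)[symmetric]
    by (simp add: matrix_mul_assoc[symmetric] EG)
  have C0: "transpose (C0 t) = P t ** B0" for t
    using assms(16) unfolding select_columns_mult assms(15)[symmetric] B0
    by (simp add: matrix_mul_assoc[symmetric] EG)
  have optimal: "lq_optimal A B Q R H t0 T x0 x u \<and>
      lq_cost Q R H t0 T x u = x0 \<bullet> ((P t0 + P1 t0) *v x0)"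
    if "irregular_solution A0 D0 B0 C0 t0 T P1" "steers_to_kernel A0 D0 B0 t0 T P1 x0 u1 x"
      "u = (\<lambda>t. - ((pinv R ** transpose B ** (P t + P1 t)) *v x t) + G0 *v u1 t)" for P1 x0 u1 x u
    using irregular_solution_optimal[OF assms(1-3) \<open>t0 \<le> T\<close> assms(5) E RG A0 assms(14) B0 C0 that]
    by blast
  have "\<exists>P1. irregular_solution A0 D0 B0 C0 t0 T P1" if solv: "lq_solvable A B Q R H t0 T"
  proof -
    have QN: "Q *v c = 0" if "c \<in> controllable_subspace A B0" for c
      using lq_solvable_controllable_kernel[OF assms(1,3,2,4) solv RG] that by (simp add: B0)
    show ?thesis
      by (rule irregular_solution_exists[OF assms(1-5) A0 assms(14) C0 QN]) (assumption, erule exI)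
  qed
  moreover have "lq_solvable A B Q R H t0 T" if irr: "irregular_solution A0 D0 B0 C0 t0 T P1" for P1
    unfolding lq_solvable_def
  proof
    fix x0
    obtain u1 x where "steers_to_kernel A0 D0 B0 t0 T P1 x0 u1 x"
      using irr unfolding irregular_solution_def by blast
    from optimal[OF irr this refl] show "\<exists>u x. lq_optimal A B Q R H t0 T x0 x u" by blast
  qed
  ultimately show ?thesis
    using optimal by (auto simp: Let_def)
qed

end
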